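(* For all $k,l\ge1$ the space $\mathrm H_{k,l}(A_k^{univ})$ is homotopy equivalent to the matrix Grassmannian $\mathrm{Gr}_{k,l}$.
   Context: $\mathrm{PU}(k)$ is the projective unitary group, identified with the group of $*$-automorphisms of $M_k(\mathbb C)$. $A_k^{univ}\to \mathrm{BPU}(k)$ is the universal locally trivial bundle with fiber $M_k(\mathbb C)$ and structure group $\mathrm{PU}(k)$. $\mathrm H_{k,l}(A_k^{univ})$ is the total space of the bundle over $\mathrm{BPU}(k)$ whose fiber over $x$ is the space of unital $*$-homomorphisms $(A_k^{univ})_x\to M_{kl}(\mathbb C)$; equivalently $\mathrm H_{k,l}(A_k^{univ})=\mathrm{EPU}(k)\times_{\mathrm{PU}(k)}\mathrm{Fr}_{k,l}$, where $\mathrm{Fr}_{k,l}=\mathrm{Hom}_{alg}(M_k(\mathbb C),M_{kl}(\mathbb C))$ is the space of unital $*$-homomorphisms. The matrix Grassmannian $\mathrm{Gr}_{k,l}$ is the space of unital $*$-subalgebras of $M_{kl}(\mathbb C)$ isomorphic to $M_k(\mathbb C)$, topologized as the homogeneous space $\mathrm{PU}(kl)/(\mathrm{PU}(k)\otimes\mathrm{PU}(l))$, where $\otimes$ is the Kronecker product of matrices. *)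

theory Defs
  imports "HOL-Analysis.Analysis"
begin

section \<open>Quotient topologies and principal bundles\<close>

definition final_topology :: "'b set \<Rightarrow> 'a topology \<Rightarrow> ('a \<Rightarrow> 'b) \<Rightarrow> 'b topology" where
  "final_topology T X f =
     topology (\<lambda>U. U \<subseteq> T \<and> openin X {x \<in> topspace X. f x \<in> U})"

lemma openin_final_topology:
  "openin (final_topology T X f) U \<longleftrightarrow> U \<subseteq> T \<and> openin X {x \<in> topspace X. f x \<in> U}"
proof -
  have "istopology (\<lambda>U. U \<subseteq> T \<and> openin X {x \<in> topspace X. f x \<in> U})"
    unfolding istopology_def
  proof (intro conjI allI impI)
    fix S S'
    assume S: "S \<subseteq> T \<and> openin X {x \<in> topspace X. f x \<in> S}"
      and S': "S' \<subseteq> T \<and> openin X {x \<in> topspace X. f x \<in> S'}"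
    show "S \<inter> S' \<subseteq> T" using S by blast
    have "{x \<in> topspace X. f x \<in> S \<inter> S'}
        = {x \<in> topspace X. f x \<in> S} \<inter> {x \<in> topspace X. f x \<in> S'}" by blast
    then show "openin X {x \<in> topspace X. f x \<in> S \<inter> S'}"
      using S S' by (simp add: openin_Int)
  next
    fix \<K>
    assume K: "\<forall>S\<in>\<K>. S \<subseteq> T \<and> openin X {x \<in> topspace X. f x \<in> S}"
    show "\<Union> \<K> \<subseteq> T" using K by blast
    have "{x \<in> topspace X. f x \<in> \<Union> \<K>} = (\<Union>S\<in>\<K>. {x \<in> topspace X. f x \<in> S})" by blast
    then show "openin X {x \<in> topspace X. f x \<in> \<Union> \<K>}"
      using K by auto
  qed
  then show ?thesis
    by (simp add: final_topology_def topology_inverse')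
qed

lemma topspace_final_topology:
  assumes "f ` topspace X \<subseteq> T"
  shows "topspace (final_topology T X f) = T"
proof -
  have "{x \<in> topspace X. f x \<in> T} = topspace X" using assms by blast
  then have "openin (final_topology T X f) T"
    by (simp add: openin_final_topology)
  then show ?thesis
    by (meson openin_final_topology openin_subset openin_topspace subset_antisym)
qed

definition orbit :: "('e \<Rightarrow> 'g \<Rightarrow> 'e) \<Rightarrow> 'g set \<Rightarrow> 'e \<Rightarrow> 'e set" where
  "orbit act G e = act e ` G"

definition orbit_space :: "'e topology \<Rightarrow> ('e \<Rightarrow> 'g \<Rightarrow> 'e) \<Rightarrow> 'g set \<Rightarrow> 'e set topology" where
  "orbit_space X act G = final_topology (orbit act G ` topspace X) X (orbit act G)"

definition continuous_right_action ::
    "'g topology \<Rightarrow> ('g \<Rightarrow> 'g \<Rightarrow> 'g) \<Rightarrow> 'g \<Rightarrow> 'e topology \<Rightarrow> ('e \<Rightarrow> 'g \<Rightarrow> 'e) \<Rightarrow> bool" where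
  "continuous_right_action G mul one E act \<longleftrightarrow>
     continuous_map (prod_topology E G) E (\<lambda>(e, g). act e g) \<and>
     (\<forall>e \<in> topspace E. act e one = e) \<and>
     (\<forall>e \<in> topspace E. \<forall>g \<in> topspace G. \<forall>h \<in> topspace G.
        act (act e g) h = act e (mul g h))"

text \<open>The base of the bundle is the orbit space, the projection sends a point to its orbit.\<close>

definition principal_bundle ::
    "'g topology \<Rightarrow> ('g \<Rightarrow> 'g \<Rightarrow> 'g) \<Rightarrow> 'g \<Rightarrow> 'e topology \<Rightarrow> ('e \<Rightarrow> 'g \<Rightarrow> 'e) \<Rightarrow> bool" where
  "principal_bundle G mul one E act \<longleftrightarrow>
     continuous_right_action G mul one E act \<and>
     (\<forall>b \<in> topspace (orbit_space E act (topspace G)).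
        \<exists>U f. openin (orbit_space E act (topspace G)) U \<and> b \<in> U \<and>
          homeomorphic_map
            (prod_topology (subtopology (orbit_space E act (topspace G)) U) G)
            (subtopology E {e \<in> topspace E. orbit act (topspace G) e \<in> U}) f \<and>
          (\<forall>u \<in> U. \<forall>g \<in> topspace G. orbit act (topspace G) (f (u, g)) = u \<and>
             (\<forall>h \<in> topspace G. f (u, mul g h) = act (f (u, g)) h)))"

text \<open>\<open>contractible_space\<close> holds for the empty space, which has to be excluded.\<close>

definition universal_principal_bundle ::
    "'g topology \<Rightarrow> ('g \<Rightarrow> 'g \<Rightarrow> 'g) \<Rightarrow> 'g \<Rightarrow> 'e topology \<Rightarrow> ('e \<Rightarrow> 'g \<Rightarrow> 'e) \<Rightarrow> bool" where
  "universal_principal_bundle G mul one E act \<longleftrightarrow>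
     principal_bundle G mul one E act \<and> topspace E \<noteq> {} \<and> contractible_space E"


section \<open>Matrix algebras and the projective unitary group\<close>

type_synonym 'n cmat = "complex ^ 'n ^ 'n"

definition cscale :: "complex \<Rightarrow> 'n::finite cmat \<Rightarrow> 'n cmat" where
  "cscale c a = (\<chi> i j. c * a $ i $ j)"

definition star :: "'n::finite cmat \<Rightarrow> 'n cmat" where
  "star a = (\<chi> i j. cnj (a $ j $ i))"

text \<open>Matrices indexed by \<open>'k \<times> 'l\<close> represent \<open>M\<^bsub>kl\<^esub>(\<complex>) = M\<^sub>k(\<complex>) \<otimes> M\<^sub>l(\<complex>)\<close>.\<close>

definition kron :: "'k::finite cmat \<Rightarrow> 'l::finite cmat \<Rightarrow> ('k \<times> 'l) cmat" where
  "kron a b = (\<chi> p q. a $ fst p $ fst q * b $ snd p $ snd q)"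

definition unitary :: "'n::finite cmat set" where
  "unitary = {u. star u ** u = mat 1 \<and> u ** star u = mat 1}"

definition Ad :: "'n::finite cmat \<Rightarrow> 'n cmat \<Rightarrow> 'n cmat" where
  "Ad u a = u ** a ** star u"

text \<open>
  The class of \<open>u\<close> in \<open>PU(n) = U(n)/U(1)\<close> is represented by the automorphism \<open>Ad u\<close>
  of \<open>M\<^sub>n(\<complex>)\<close>; by \<open>Ad_eq_iff\<close> below this is the quotient by the scalars of modulus 1.
  The group law is composition of maps.
\<close>

definition PU :: "('n::finite cmat \<Rightarrow> 'n cmat) topology" where
  "PU = final_topology (Ad ` unitary) (top_of_set unitary) Ad"

definition unital_star_hom :: "('m::finite cmat \<Rightarrow> 'n::finite cmat) \<Rightarrow> bool" where
  "unital_star_hom \<phi> \<longleftrightarrow>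
     (\<forall>a b. \<phi> (a + b) = \<phi> a + \<phi> b) \<and>
     (\<forall>c a. \<phi> (cscale c a) = cscale c (\<phi> a)) \<and>
     (\<forall>a b. \<phi> (a ** b) = \<phi> a ** \<phi> b) \<and>
     (\<forall>a. \<phi> (star a) = star (\<phi> a)) \<and>
     \<phi> (mat 1) = mat 1"

definition unital_star_subalgebra :: "'n::finite cmat set \<Rightarrow> bool" where
  "unital_star_subalgebra S \<longleftrightarrow>
     (\<forall>a \<in> S. \<forall>b \<in> S. a + b \<in> S) \<and>
     (\<forall>c. \<forall>a \<in> S. cscale c a \<in> S) \<and>
     (\<forall>a \<in> S. \<forall>b \<in> S. a ** b \<in> S) \<and>
     (\<forall>a \<in> S. star a \<in> S) \<and>
     mat 1 \<in> S"


section \<open>Frames, the matrix Grassmannian and the bundle of homomorphisms\<close>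

text \<open>
  The topology on the function space is that of pointwise convergence, which on linear maps
  between finite-dimensional spaces is the norm topology.
\<close>

definition Fr :: "('k::finite cmat \<Rightarrow> ('k \<times> 'l::finite) cmat) topology" where
  "Fr = top_of_set {\<phi>. unital_star_hom \<phi>}"

definition matrix_subalgebras :: "('k::finite \<times> 'l::finite) cmat set set" where
  "matrix_subalgebras = {S. unital_star_subalgebra S \<and>
     (\<exists>\<phi> :: 'k cmat \<Rightarrow> ('k \<times> 'l) cmat. unital_star_hom \<phi> \<and> bij_betw \<phi> UNIV S)}"

definition PU_kron :: "(('k::finite \<times> 'l::finite) cmat \<Rightarrow> ('k \<times> 'l) cmat) set" where
  "PU_kron = {Ad (kron g h) | (g :: 'k cmat) (h :: 'l cmat). g \<in> unitary \<and> h \<in> unitary}"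

definition homogeneous_space ::
    "(('k::finite \<times> 'l::finite) cmat \<Rightarrow> ('k \<times> 'l) cmat) set topology" where
  "homogeneous_space = orbit_space PU (\<circ>) PU_kron"

text \<open>
  The left coset of \<open>\<alpha>\<close> modulo \<open>PU(k) \<otimes> PU(l)\<close> corresponds to the subalgebra
  \<open>\<alpha>(M\<^sub>k(\<complex>) \<otimes> 1)\<close>, which does not depend on the representative \<open>\<alpha>\<close>.
\<close>

definition coset_subalgebra ::
    "(('k::finite \<times> 'l::finite) cmat \<Rightarrow> ('k \<times> 'l) cmat) set \<Rightarrow> ('k \<times> 'l) cmat set" where
  "coset_subalgebra C = (\<Union>\<alpha> \<in> C. \<alpha> ` range (\<lambda>a :: 'k cmat. kron a (mat 1)))"

definition Gr :: "('k::finite \<times> 'l::finite) cmat set topology" where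
  "Gr = final_topology matrix_subalgebras homogeneous_space coset_subalgebra"

text \<open>
  For a right \<open>PU(k)\<close>-space \<open>E\<close> this is \<open>E \<times>\<^bsub>PU(k)\<^esub> Fr\<close>.  The class of \<open>(e, \<phi>)\<close> is the
  homomorphism \<open>[e, a] \<mapsto> \<phi> a\<close> on the fibre, over the orbit of \<open>e\<close>, of the associated
  bundle \<open>E \<times>\<^bsub>PU(k)\<^esub> M\<^sub>k(\<complex>)\<close>, where \<open>[e g, a] = [e, g a]\<close>; hence
  \<open>(e, \<phi>)\<close> and \<open>(e g, \<phi> \<circ> g)\<close> are identified.
\<close>

definition hom_bundle ::
    "'e topology \<Rightarrow> ('e \<Rightarrow> ('k::finite cmat \<Rightarrow> 'k cmat) \<Rightarrow> 'e) \<Rightarrow>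
     ('e \<times> ('k cmat \<Rightarrow> ('k \<times> 'l::finite) cmat)) set topology" where
  "hom_bundle E act =
     orbit_space (prod_topology E Fr) (\<lambda>(e, \<phi>) g. (act e g, \<phi> \<circ> g)) (topspace PU)"


section \<open>Consistency of the encodings\<close>

lemma star_mult: "star (a ** b) = star b ** star a"
  by (simp add: star_def matrix_matrix_mult_def vec_eq_iff mult.commute)

lemma star_star [simp]: "star (star a) = a"
  by (simp add: star_def vec_eq_iff)

lemma cscale_mult_left: "cscale c a ** b = cscale c (a ** b)"
  by (simp add: cscale_def matrix_matrix_mult_def vec_eq_iff sum_distrib_left mult_ac)

lemma cscale_mult_right: "a ** cscale c b = cscale c (a ** b)"
  by (simp add: cscale_def matrix_matrix_mult_def vec_eq_iff sum_distrib_left mult_ac)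

lemma cscale_cscale: "cscale c (cscale d a) = cscale (c * d) a"
  by (simp add: cscale_def vec_eq_iff mult.assoc)

lemma cscale_one [simp]: "cscale 1 a = a"
  by (simp add: cscale_def vec_eq_iff)

lemma commute_all_imp_scalar:
  fixes w :: "'n::finite cmat"
  assumes "\<And>a. w ** a = a ** w"
  shows "\<exists>c. w = cscale c (mat 1)"
proof -
  define e :: "'n \<Rightarrow> 'n \<Rightarrow> 'n cmat" where
    "e p q = (\<chi> i j. if i = p \<and> j = q then 1 else 0)" for p q
  have l: "\<And>p q i j. (w ** e p q) $ i $ j = (if j = q then w $ i $ p else 0)"
    by (simp add: e_def matrix_matrix_mult_def if_distrib[of "\<lambda>x. _ * x"] cong: if_cong)
  have r: "\<And>p q i j. (e p q ** w) $ i $ j = (if i = p then w $ q $ j else 0)"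
    by (simp add: e_def matrix_matrix_mult_def if_distrib[of "\<lambda>x. x * _"] cong: if_cong)
  define p where "p = (undefined :: 'n)"
  define c where "c = w $ p $ p"
  have diag: "w $ j $ j = c" for j
  proof -
    have "w $ j $ j = (e p j ** w) $ p $ j" by (subst r) simp
    also have "\<dots> = (w ** e p j) $ p $ j" by (simp only: assms)
    also have "\<dots> = c" by (subst l) (simp add: c_def)
    finally show ?thesis .
  qed
  have off: "w $ i $ j = 0" if "i \<noteq> j" for i j
  proof -
    have "w $ i $ j = (w ** e j j) $ i $ j" by (subst l) simp
    also have "\<dots> = (e j j ** w) $ i $ j" by (simp only: assms)
    also have "\<dots> = 0" by (subst r) (simp add: that)
    finally show ?thesis .
  qed
  have "w = cscale c (mat 1)"
    by (auto simp: cscale_def mat_def vec_eq_iff diag off)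
  then show ?thesis by blast
qed

lemma Ad_eq_iff:
  fixes u v :: "'n::finite cmat"
  assumes u: "u \<in> unitary" and v: "v \<in> unitary"
  shows "Ad u = Ad v \<longleftrightarrow> (\<exists>c. norm c = 1 \<and> u = cscale c v)"
proof
  assume eq: "Ad u = Ad v"
  define w where "w = star v ** u"
  have uu: "star u ** u = mat 1" "u ** star u = mat 1"
    and vv: "star v ** v = mat 1" "v ** star v = mat 1"
    using u v by (auto simp: unitary_def)
  have "w ** a = a ** w" for a
  proof -
    have "u ** a ** star u = v ** a ** star v" using fun_cong[OF eq, of a] by (simp add: Ad_def)
    then have "star v ** (u ** a ** star u) ** u = star v ** (v ** a ** star v) ** u" by simp
    then have "w ** a ** (star u ** u) = (star v ** v) ** a ** w"
      by (simp add: w_def matrix_mul_assoc)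
    then show ?thesis using uu vv by simp
  qed
  then obtain c where c: "w = cscale c (mat 1)" using commute_all_imp_scalar by blast
  have "v ** w = u" by (simp add: w_def matrix_mul_assoc vv)
  then have uc: "u = cscale c v" by (simp add: c cscale_mult_right)
  have "star w ** w = star u ** (v ** star v) ** u"
    by (simp add: w_def star_mult matrix_mul_assoc)
  then have "star w ** w = mat 1" using vv uu by simp
  moreover have "star w ** w = cscale (cnj c * c) (mat 1)"
  proof -
    have "star w = cscale (cnj c) (mat 1)"
      by (auto simp: c star_def cscale_def mat_def vec_eq_iff)
    then show ?thesis
      by (simp add: c cscale_mult_left cscale_cscale)
  qed
  ultimately have "cscale (cnj c * c) (mat 1 :: 'n cmat) = mat 1" by simp
  then have "cnj c * c = 1"
    by (auto simp: cscale_def mat_def vec_eq_iff split: if_splits)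
  then have "(norm c)\<^sup>2 = 1"
    using complex_norm_square[of c] by (metis mult.commute of_real_eq_1_iff)
  then have "norm c = 1"
    by (metis norm_ge_zero one_power2 power2_eq_imp_eq zero_le_one)
  with uc show "\<exists>c. norm c = 1 \<and> u = cscale c v" by blast
next
  assume "\<exists>c. norm c = 1 \<and> u = cscale c v"
  then obtain c where c: "norm c = 1" "u = cscale c v" by blast
  have s: "star (cscale c v) = cscale (cnj c) (star v)"
    by (simp add: star_def cscale_def vec_eq_iff)
  have "c * cnj c = 1" using c(1) by (metis complex_norm_square of_real_1 one_power2)
  then have "cnj c * c = 1" by (simp add: mult.commute)
  with \<open>c * cnj c = 1\<close> show "Ad u = Ad v"
    by (simp add: fun_eq_iff Ad_def s c(2) cscale_mult_left cscale_mult_right cscale_cscale)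
qed

lemma matrix_add_rdistr: "((a :: 'n::finite cmat) + b) ** c = a ** c + b ** c"
  by (simp add: matrix_matrix_mult_def vec_eq_iff algebra_simps sum.distrib)

lemma cscale_add: "cscale c (a + b) = cscale c a + cscale c b"
  by (simp add: cscale_def vec_eq_iff algebra_simps)

lemma star_add: "star (a + b) = star a + star b"
  by (simp add: star_def vec_eq_iff)

lemma star_cscale: "star (cscale c a) = cscale (cnj c) (star a)"
  by (simp add: star_def cscale_def vec_eq_iff)

lemma star_one [simp]: "star (mat 1) = mat 1"
  by (auto simp: star_def mat_def vec_eq_iff)

lemma kron_mult: "kron a b ** kron c d = kron (a ** c) (b ** d)"
proof -
  have "(kron a b ** kron c d) $ (i, i') $ (j, j') = kron (a ** c) (b ** d) $ (i, i') $ (j, j')"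
    for i i' j j'
  proof -
    have "(kron a b ** kron c d) $ (i, i') $ (j, j')
        = (\<Sum>(m, m') \<in> UNIV \<times> UNIV. (a $ i $ m * c $ m $ j) * (b $ i' $ m' * d $ m' $ j'))"
      unfolding UNIV_Times_UNIV
      by (simp add: kron_def matrix_matrix_mult_def case_prod_beta mult_ac)
    also have "\<dots> = kron (a ** c) (b ** d) $ (i, i') $ (j, j')"
      by (simp only: kron_def matrix_matrix_mult_def vec_lambda_beta fst_conv snd_conv
          sum_product sum.cartesian_product)
    finally show ?thesis .
  qed
  then show ?thesis by (auto simp: vec_eq_iff)
qed

lemma star_kron: "star (kron a b) = kron (star a) (star b)"
  by (simp add: star_def kron_def vec_eq_iff)

lemma kron_one: "kron (mat 1) (mat 1) = mat 1"
  by (auto simp: kron_def mat_def vec_eq_iff prod_eq_iff)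

lemma unital_star_hom_kron_one:
  "unital_star_hom (\<lambda>a. kron a (mat 1 :: 'l::finite cmat))"
  unfolding unital_star_hom_def
  by (intro conjI allI)
     (simp_all add: kron_mult star_kron kron_one,
      simp_all add: kron_def cscale_def vec_eq_iff distrib_right mult.assoc)

lemma inj_kron_one: "inj (\<lambda>a. kron a (mat 1 :: 'l::finite cmat))"
proof (rule injI)
  fix a b :: "'k::finite cmat"
  assume eq: "kron a (mat 1 :: 'l cmat) = kron b (mat 1)"
  have "a $ i $ j = b $ i $ j" for i j
    using arg_cong[OF eq, of "\<lambda>m. m $ (i, undefined) $ (j, undefined)"]
    by (simp add: kron_def mat_def)
  then show "a = b" by (simp add: vec_eq_iff)
qed

lemma unital_star_hom_Ad:
  assumes "u \<in> unitary"
  shows "unital_star_hom (Ad u)"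
proof -
  have uu: "star u ** u = mat 1" "u ** star u = mat 1"
    using assms by (auto simp: unitary_def)
  have "u ** (a ** b) ** star u = (u ** a ** star u) ** (u ** b ** star u)" for a b
  proof -
    have "(u ** a ** star u) ** (u ** b ** star u) = u ** a ** (star u ** u) ** b ** star u"
      by (simp only: matrix_mul_assoc)
    then show ?thesis by (simp add: uu matrix_mul_assoc)
  qed
  then show ?thesis
    unfolding unital_star_hom_def
    by (simp add: Ad_def uu star_mult matrix_mul_assoc
        cscale_mult_left cscale_mult_right matrix_add_ldistrib matrix_add_rdistr)
qed

lemma inj_Ad:
  assumes "u \<in> unitary"
  shows "inj (Ad u)"
proof -
  have uu: "star u ** u = mat 1" using assms by (auto simp: unitary_def)
  have "star u ** Ad u a ** u = a" for a
  proof -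
    have "star u ** Ad u a ** u = (star u ** u) ** a ** (star u ** u)"
      by (simp only: Ad_def matrix_mul_assoc)
    then show ?thesis by (simp add: uu)
  qed
  then show ?thesis by (rule inj_on_inverseI)
qed

lemma unital_star_hom_comp:
  assumes "unital_star_hom f" "unital_star_hom g"
  shows "unital_star_hom (f \<circ> g)"
  using assms by (simp add: unital_star_hom_def)

lemma unital_star_subalgebra_range:
  assumes "unital_star_hom f"
  shows "unital_star_subalgebra (range f)"
proof -
  have "f a + f b = f (a + b)" "cscale c (f a) = f (cscale c a)" "f a ** f b = f (a ** b)"
    "star (f a) = f (star a)" "mat 1 = f (mat 1)" for a b c
    using assms by (simp_all add: unital_star_hom_def)
  then show ?thesis
    unfolding unital_star_subalgebra_def ball_simps by (intro conjI allI) (simp_all only: rangeI)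
qed

lemma topspace_PU: "topspace PU = Ad ` unitary"
  by (simp add: PU_def topspace_final_topology)

lemma one_unitary: "mat 1 \<in> unitary"
  by (simp add: unitary_def)

lemma unitary_kron:
  assumes "g \<in> unitary" "h \<in> unitary"
  shows "kron g h \<in> unitary"
  using assms by (simp add: unitary_def star_kron kron_mult kron_one)

lemma coset_subalgebra_orbit:
  fixes \<alpha> :: "('k::finite \<times> 'l::finite) cmat \<Rightarrow> ('k \<times> 'l) cmat"
  shows "coset_subalgebra (orbit (\<circ>) PU_kron \<alpha>) = \<alpha> ` range (\<lambda>a :: 'k cmat. kron a (mat 1))"
proof -
  have *: "Ad (kron g h) ` range (\<lambda>a :: 'k cmat. kron a (mat 1)) = range (\<lambda>a. kron a (mat 1))"
    if g: "g \<in> unitary" and h: "h \<in> unitary" for g :: "'k cmat" and h :: "'l cmat"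
  proof -
    have Ad_kron: "Ad (kron g h) (kron a (mat 1)) = kron (Ad g a) (mat 1)" for a
      using h by (simp add: Ad_def star_kron kron_mult unitary_def)
    have surj: "range (Ad g) = UNIV"
    proof -
      have "Ad g (star g ** a ** g) = a" for a
      proof -
        have "Ad g (star g ** a ** g) = (g ** star g) ** a ** (g ** star g)"
          by (simp only: Ad_def matrix_mul_assoc)
        then show ?thesis using g by (simp add: unitary_def)
      qed
      then show ?thesis by (rule surjI)
    qed
    have "Ad (kron g h) ` range (\<lambda>a :: 'k cmat. kron a (mat 1))
        = (\<lambda>a. kron a (mat 1)) ` range (Ad g)"
      by (simp only: image_image Ad_kron)
    then show ?thesis unfolding surj .
  qed
  have ne: "Ad (kron (mat 1 :: 'k cmat) (mat 1 :: 'l cmat)) \<in> PU_kron"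
    unfolding PU_kron_def by (intro CollectI exI conjI) (rule refl one_unitary)+
  have img: "\<gamma> ` range (\<lambda>a :: 'k cmat. kron a (mat 1)) = \<alpha> ` range (\<lambda>a :: 'k cmat. kron a (mat 1))"
    if \<gamma>: "\<gamma> \<in> orbit (\<circ>) PU_kron \<alpha>" for \<gamma>
  proof -
    obtain g :: "'k cmat" and h :: "'l cmat"
      where gh: "\<gamma> = \<alpha> \<circ> Ad (kron g h)" "g \<in> unitary" "h \<in> unitary"
      using \<gamma> unfolding orbit_def PU_kron_def by blast
    show ?thesis unfolding gh(1) image_comp[symmetric] *[OF gh(2,3)] by (rule refl)
  qed
  have "\<alpha> \<circ> Ad (kron (mat 1) (mat 1)) \<in> orbit (\<circ>) PU_kron \<alpha>"
    unfolding orbit_def by (rule imageI[OF ne])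
  then have "orbit (\<circ>) PU_kron \<alpha> \<noteq> {}" by (rule ex_in_conv[THEN iffD1, OF exI])
  then show ?thesis
    unfolding coset_subalgebra_def by (simp add: img cong: SUP_cong)
qed

lemma topspace_Gr:
  "topspace (Gr :: ('k::finite \<times> 'l::finite) cmat set topology) = matrix_subalgebras"
  unfolding Gr_def
proof (rule topspace_final_topology, rule image_subsetI)
  fix C :: "(('k \<times> 'l) cmat \<Rightarrow> ('k \<times> 'l) cmat) set"
  assume "C \<in> topspace homogeneous_space"
  then obtain u :: "('k \<times> 'l) cmat" where u: "u \<in> unitary" "C = orbit (\<circ>) PU_kron (Ad u)"
    by (auto simp: homogeneous_space_def orbit_space_def topspace_final_topology topspace_PU)
  define \<phi> where "\<phi> = Ad u \<circ> (\<lambda>a :: 'k cmat. kron a (mat 1))"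
  have "coset_subalgebra C = range \<phi>"
    by (simp add: u(2) coset_subalgebra_orbit \<phi>_def image_comp)
  moreover have "unital_star_hom \<phi>"
    unfolding \<phi>_def by (intro unital_star_hom_comp unital_star_hom_Ad unital_star_hom_kron_one u(1))
  moreover have "inj \<phi>"
    unfolding \<phi>_def by (intro inj_compose inj_Ad inj_kron_one u(1))
  ultimately show "coset_subalgebra C \<in> matrix_subalgebras"
    by (auto simp: matrix_subalgebras_def unital_star_subalgebra_range bij_betw_def)
qed

end

theory Submission
  imports Defs
begin

text \<open>
  Write \<open>G = PU(k)\<close>.  The space \<open>E \<times>\<^bsub>G\<^esub> Fr\<close> has two projections.  The one to \<open>E/G\<close> is the bundle
  that defines it; the proof uses the other one, to \<open>Fr/G\<close>.  Its fibre over a class is a copy of the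
  contractible space \<open>E\<close>, and \<open>Fr/G\<close> is the matrix Grassmannian: two unital star homomorphisms
  have the same image exactly when they differ by an automorphism of \<open>M\<^sub>k(\<complex>)\<close>, and \<open>U(kl)\<close> acts
  transitively on \<open>Fr\<close>, so that \<open>Fr\<close> and \<open>Gr\<close> both carry the quotient topology from \<open>U(kl)\<close>
  (\<open>unital_star_hom_eq_Ad_kron\<close>, \<open>range_eq_iff_same_PU_orbit\<close>, \<open>quotient_map_Fr_Gr\<close>).
  It remains to see that the projection to \<open>Fr/G\<close> is a homotopy equivalence.

  All spaces over \<open>Fr/G\<close> are described by equivariant data over \<open>Fr\<close>.  A homotopy inverse together with
  its homotopy is given by an equivariant deformation of \<open>E \<times> Fr\<close> over \<open>Fr\<close> which, at time 1, sends
  \<open>(e, \<phi>)\<close> to a point that does not depend on \<open>e\<close>.  Where a continuous equivariant map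
  \<open>h\<close> to \<open>G\<close> is defined, such a deformation is obtained from a contraction \<open>c\<close> of \<open>E\<close> as
  \<open>c (t, e h(\<phi>)\<^sup>-\<^sup>1) h(\<phi>)\<close>; an invariant cutoff function in the time variable extends it
  to all of \<open>Fr\<close> (\<open>locally_shrinkable\<close>).  Local deformations are glued by composing them: a
  composite of self-maps of \<open>E\<close> is constant as soon as one factor is constant
  (\<open>shrinkable_over_Un\<close>).  As \<open>Fr\<close> is compact, finitely many local deformations suffice.

  What is left is a continuous equivariant map to \<open>G\<close> near every frame \<open>\<phi>0\<close>, that is, the local
  triviality of \<open>Fr \<rightarrow> Gr\<close>.  Given a frame \<open>\<phi>\<close>, let the unit vector \<open>x\<close> maximize
  \<open>Re tr (\<phi>(x x\<^sup>*) \<phi>0(e\<^sub>1\<^sub>1))\<close>, which makes the image under \<open>\<phi>\<close> of the line of \<open>x\<close> as close as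
  possible to \<open>\<phi>0(e\<^sub>1\<^sub>1)\<close>.  Comparing \<open>\<phi>(x e\<^sub>j\<^sup>*)\<close> with \<open>\<phi>0(e\<^sub>i\<^sub>1)\<close> gives a \<open>k \<times> k\<close> matrix,
  whose unitary polar part \<open>u\<close> again maximizes a real function, \<open>Re tr (u\<^sup>* v)\<close>, over a compact set.
  Near \<open>\<phi>0\<close> both maximizers are unique up to one common phase, so \<open>Ad u\<^sup>*\<close> is well defined.
  Defining things by maximization pays twice: uniqueness makes the map equivariant, because the functions
  maximized are, and uniqueness with compactness makes it continuous
  (\<open>continuous_map_of_closed_relation\<close>).
\<close>

section \<open>Actions of compact groups\<close>

text \<open>
  A function whose value is read off from any solution of a closed condition with parameters in a compact
  space is continuous: preimages of closed sets are projections of closed sets along the compact factor.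
  It gives the continuity of quantities defined by maximization.
\<close>

lemma continuous_map_of_closed_relation:
  assumes K: "compact_space K"
    and R: "closedin (prod_topology X K) R"
    and f: "continuous_map K Y f"
    and ex: "\<And>x. x \<in> topspace X \<Longrightarrow> \<exists>k. (x, k) \<in> R"
    and val: "\<And>x k. (x, k) \<in> R \<Longrightarrow> h x = f k"
  shows "continuous_map X Y h"
  unfolding continuous_map_closedin
proof (intro conjI allI impI Pi_I)
  have RX: "R \<subseteq> topspace X \<times> topspace K"
    using closedin_subset[OF R] by simp
  fix x assume "x \<in> topspace X"
  then obtain k where k: "(x, k) \<in> R" using ex by blast
  then have "k \<in> topspace K" using RX by blast
  then show "h x \<in> topspace Y"
    using val[OF k] continuous_map_image_subset_topspace[OF f] by auto
next
  have RX: "R \<subseteq> topspace X \<times> topspace K"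
    using closedin_subset[OF R] by simp
  fix C assume C: "closedin Y C"
  have "closedin (prod_topology X K) {z \<in> topspace (prod_topology X K). (f \<circ> snd) z \<in> C}"
    by (intro closedin_continuous_map_preimage[OF _ C] continuous_map_compose[OF continuous_map_snd f])
  then have "closedin (prod_topology X K)
      (R \<inter> {z \<in> topspace (prod_topology X K). (f \<circ> snd) z \<in> C})"
    using R by (rule closedin_Int[rotated])
  then have "closedin X (fst ` (R \<inter> {z \<in> topspace (prod_topology X K). (f \<circ> snd) z \<in> C}))"
    using Abstract_Topological_Spaces.closed_map_fst[OF K] unfolding closed_map_def by blast
  moreover have "fst ` (R \<inter> {z \<in> topspace (prod_topology X K). (f \<circ> snd) z \<in> C})
      = {x \<in> topspace X. h x \<in> C}"
  proof
    show "fst ` (R \<inter> {z \<in> topspace (prod_topology X K). (f \<circ> snd) z \<in> C}) \<subseteq> {x \<in> topspace X. h x \<in> C}"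
      using RX val by auto
    show "{x \<in> topspace X. h x \<in> C} \<subseteq> fst ` (R \<inter> {z \<in> topspace (prod_topology X K). (f \<circ> snd) z \<in> C})"
    proof
      fix x assume x: "x \<in> {x \<in> topspace X. h x \<in> C}"
      then obtain k where "(x, k) \<in> R" using ex by blast
      then have "(x, k) \<in> R \<inter> {z \<in> topspace (prod_topology X K). (f \<circ> snd) z \<in> C}"
        using x val RX by auto
      then show "x \<in> fst ` (R \<inter> {z \<in> topspace (prod_topology X K). (f \<circ> snd) z \<in> C})"
        by (rule rev_image_eqI) simp
    qed
  qed
  ultimately show "closedin X {x \<in> topspace X. h x \<in> C}" by simp
qed

lemma continuous_map_right_action:
  assumes "continuous_right_action G mul one E act" "continuous_map Z E f" "continuous_map Z G g"
  shows "continuous_map Z E (\<lambda>z. act (f z) (g z))"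
proof -
  have "continuous_map (prod_topology E G) E (\<lambda>(e, g). act e g)"
    using assms(1) by (simp add: continuous_right_action_def)
  then have "continuous_map Z E ((\<lambda>(e, g). act e g) \<circ> (\<lambda>z. (f z, g z)))"
    by (intro continuous_map_compose[OF continuous_map_pairedI[OF assms(2,3)]])
  then show ?thesis by (simp add: o_def)
qed

lemma right_action_closed:
  assumes "continuous_right_action G mul one E act" "e \<in> topspace E" "g \<in> topspace G"
  shows "act e g \<in> topspace E"
proof -
  have "continuous_map (prod_topology E G) E (\<lambda>(e, g). act e g)"
    using assms(1) by (simp add: continuous_right_action_def)
  from continuous_map_image_subset_topspace[OF this] show ?thesis using assms(2,3) by auto
qed

lemma quotient_map_final_topology:
  assumes "f ` topspace X = T"
  shows "quotient_map X (final_topology T X f) f"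
  using assms by (auto simp: quotient_map_def openin_final_topology topspace_final_topology)

text \<open>
  The group enters through its continuous right actions, which carry the continuity of multiplication,
  and through translation by inverses; therefore inversion is the operation whose continuity is recorded.
\<close>

locale compact_group =
  fixes G :: "'g topology" and mul :: "'g \<Rightarrow> 'g \<Rightarrow> 'g" and one :: 'g and iv :: "'g \<Rightarrow> 'g"
  assumes compact: "compact_space G"
    and one_closed: "one \<in> topspace G"
    and mul_closed: "\<lbrakk>g \<in> topspace G; h \<in> topspace G\<rbrakk> \<Longrightarrow> mul g h \<in> topspace G"
    and mul_assoc: "\<lbrakk>g \<in> topspace G; h \<in> topspace G; k \<in> topspace G\<rbrakk>
      \<Longrightarrow> mul (mul g h) k = mul g (mul h k)"
    and mul_one: "g \<in> topspace G \<Longrightarrow> mul g one = g"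
    and one_mul: "g \<in> topspace G \<Longrightarrow> mul one g = g"
    and mul_iv: "g \<in> topspace G \<Longrightarrow> mul g (iv g) = one"
    and iv_mul: "g \<in> topspace G \<Longrightarrow> mul (iv g) g = one"
    and continuous_iv: "continuous_map G G iv"
begin

lemma iv_closed: "g \<in> topspace G \<Longrightarrow> iv g \<in> topspace G"
  using continuous_map_image_subset_topspace[OF continuous_iv] by blast

text \<open>
  This is the identity \<open>g (h g)\<^sup>-\<^sup>1 = h\<^sup>-\<^sup>1\<close> that makes \<open>e h(x)\<^sup>-\<^sup>1\<close> invariant
  when \<open>h\<close> is equivariant.
\<close>

lemma mul_iv_mul_cancel:
  assumes "g \<in> topspace G" "h \<in> topspace G"
  shows "mul g (iv (mul h g)) = iv h"
proof -
  let ?k = "iv (mul h g)"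
  have k: "?k \<in> topspace G" using assms by (simp add: iv_closed mul_closed)
  have "mul (iv h) (mul (mul h g) ?k) = iv h"
    using assms by (simp add: mul_iv mul_closed mul_one iv_closed)
  moreover have "mul (iv h) (mul (mul h g) ?k) = mul g ?k"
    using assms k by (simp add: mul_assoc[symmetric] mul_closed iv_closed iv_mul one_mul)
  ultimately show ?thesis by simp
qed

context
  fixes X :: "'x topology" and act :: "'x \<Rightarrow> 'g \<Rightarrow> 'x"
  assumes act: "continuous_right_action G mul one X act"
begin

lemma act_closed: "\<lbrakk>x \<in> topspace X; g \<in> topspace G\<rbrakk> \<Longrightarrow> act x g \<in> topspace X"
  by (rule right_action_closed[OF act])

lemma act_one: "x \<in> topspace X \<Longrightarrow> act x one = x"
  using act by (simp add: continuous_right_action_def)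

lemma act_act:
  "\<lbrakk>x \<in> topspace X; g \<in> topspace G; h \<in> topspace G\<rbrakk> \<Longrightarrow> act (act x g) h = act x (mul g h)"
  using act by (simp add: continuous_right_action_def)

lemma act_act_iv: "\<lbrakk>x \<in> topspace X; g \<in> topspace G\<rbrakk> \<Longrightarrow> act (act x g) (iv g) = x"
  by (simp add: act_act iv_closed mul_iv act_one)

lemma act_iv_act: "\<lbrakk>x \<in> topspace X; g \<in> topspace G\<rbrakk> \<Longrightarrow> act (act x (iv g)) g = x"
  by (simp add: act_act iv_closed iv_mul act_one)

lemma orbit_eq_iff:
  assumes x: "x \<in> topspace X" and y: "y \<in> topspace X"
  shows "orbit act (topspace G) x = orbit act (topspace G) y \<longleftrightarrow> (\<exists>g \<in> topspace G. y = act x g)"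
proof
  assume "orbit act (topspace G) x = orbit act (topspace G) y"
  moreover have "y \<in> orbit act (topspace G) y"
    unfolding orbit_def using one_closed act_one[OF y] by force
  ultimately show "\<exists>g \<in> topspace G. y = act x g" by (auto simp: orbit_def)
next
  assume "\<exists>g \<in> topspace G. y = act x g"
  then obtain g where g: "g \<in> topspace G" "y = act x g" by blast
  have "act x h \<in> orbit act (topspace G) y" if h: "h \<in> topspace G" for h
  proof -
    have "act y (mul (iv g) h) = act x h"
      using act_act[of y "iv g" h] y g h act_act_iv[OF x g(1)] by (simp add: iv_closed)
    then show ?thesis
      unfolding orbit_def using g h by (metis image_eqI iv_closed mul_closed)
  qed
  moreover have "act y h \<in> orbit act (topspace G) x" if h: "h \<in> topspace G" for h
    unfolding orbit_def using g h act_act[OF x g(1) h] mul_closed by auto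
  ultimately show "orbit act (topspace G) x = orbit act (topspace G) y"
    unfolding orbit_def by blast
qed

lemma quotient_map_orbit: "quotient_map X (orbit_space X act (topspace G)) (orbit act (topspace G))"
  unfolding orbit_space_def by (rule quotient_map_final_topology) (rule refl)

text \<open>
  The saturation of an open set \<open>U\<close> is the projection of the open set of all \<open>(x, g)\<close> with
  \<open>x g \<in> U\<close>.  Openness is what lets the quotient by the group commute with the product with an interval.
\<close>

lemma open_map_orbit: "open_map X (orbit_space X act (topspace G)) (orbit act (topspace G))"
  unfolding open_map_def
proof (intro allI impI)
  fix U assume U: "openin X U"
  have UX: "U \<subseteq> topspace X" by (rule openin_subset[OF U])
  let ?A = "{z \<in> topspace (prod_topology X G). (\<lambda>(x, g). act x g) z \<in> U}"
  have "openin (prod_topology X G) ?A"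
    using act by (intro openin_continuous_map_preimage[OF _ U]) (simp add: continuous_right_action_def)
  then have "openin X (fst ` ?A)"
    using open_map_fst unfolding open_map_def by blast
  moreover have "fst ` ?A = {x \<in> topspace X. orbit act (topspace G) x \<in> orbit act (topspace G) ` U}"
  proof (intro subset_antisym subsetI)
    fix x assume "x \<in> fst ` ?A"
    then obtain g where g: "x \<in> topspace X" "g \<in> topspace G" "act x g \<in> U" by auto
    then have "orbit act (topspace G) x = orbit act (topspace G) (act x g)"
      by (subst orbit_eq_iff) (auto intro: act_closed)
    then show "x \<in> {x \<in> topspace X. orbit act (topspace G) x \<in> orbit act (topspace G) ` U}"
      using g by auto
  next
    fix x assume "x \<in> {x \<in> topspace X. orbit act (topspace G) x \<in> orbit act (topspace G) ` U}"
    then obtain y where y: "x \<in> topspace X" "y \<in> U"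
        "orbit act (topspace G) x = orbit act (topspace G) y" by auto
    then obtain g where "g \<in> topspace G" "y = act x g"
      using orbit_eq_iff[of x y] UX by auto
    then have "(x, g) \<in> ?A" using y by auto
    then show "x \<in> fst ` ?A" by (rule rev_image_eqI) simp
  qed
  ultimately show "openin (orbit_space X act (topspace G)) (orbit act (topspace G) ` U)"
    using UX by (simp add: orbit_space_def openin_final_topology image_mono)
qed

text \<open>
  The supremum over each orbit of a function that separates \<open>x0\<close> from the complement of \<open>U\<close> is invariant.
  It is lower semicontinuous because projections are open and upper semicontinuous because projections along
  the compact group are closed.
\<close>

lemma invariant_bump_function:
  assumes X: "completely_regular_space X"
    and U: "openin X U" and x0: "x0 \<in> U"
    and inv: "\<And>x g. \<lbrakk>x \<in> U; g \<in> topspace G\<rbrakk> \<Longrightarrow> act x g \<in> U"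
  obtains m :: "'x \<Rightarrow> real" where "continuous_map X euclidean m"
    "\<And>x g. \<lbrakk>x \<in> topspace X; g \<in> topspace G\<rbrakk> \<Longrightarrow> m (act x g) = m x"
    "m x0 = 1" "\<And>x. x \<in> topspace X \<Longrightarrow> 0 \<le> m x \<and> m x \<le> 1"
    "\<And>x. x \<in> topspace X - U \<Longrightarrow> m x = 0"
proof -
  have UX: "U \<subseteq> topspace X" by (rule openin_subset[OF U])
  have x0X: "x0 \<in> topspace X" using x0 UX by blast
  have "closedin X (topspace X - U)" using U by blast
  then obtain f' :: "'x \<Rightarrow> real" where f': "continuous_map X (top_of_set {0..1}) f'"
      "f' x0 = 0" "f' ` (topspace X - U) \<subseteq> {1}"
    using X x0 x0X unfolding completely_regular_space_def by (metis DiffD2 DiffI)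
  define f where "f x = 1 - f' x" for x
  have f'01: "f' x \<in> {0..1}" if "x \<in> topspace X" for x
    using continuous_map_image_subset_topspace[OF f'(1)] that by auto
  have "continuous_map X euclidean f'" using f'(1) by (simp add: continuous_map_in_subtopology)
  then have f: "continuous_map X euclidean f"
    unfolding f_def by (intro continuous_intros) auto
  have f01: "0 \<le> f x" "f x \<le> 1" if "x \<in> topspace X" for x
    using f'01[OF that] by (auto simp: f_def)
  define A where "A x = (\<lambda>g. f (act x g)) ` topspace G" for x
  define m where "m x = Sup (A x)" for x
  have fact: "continuous_map (prod_topology X G) euclidean (\<lambda>z. f (act (fst z) (snd z)))"
    using continuous_map_compose[OF continuous_map_right_action[OF act continuous_map_fst continuous_map_snd] f]
    by (simp add: o_def)
  have comp: "compact (A x)" if x: "x \<in> topspace X" for x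
  proof -
    have "continuous_map G euclidean (\<lambda>g. f (act x g))"
      using continuous_map_compose[OF continuous_map_right_action[OF act, of G "\<lambda>_. x" "\<lambda>g. g"] f] x
      by (simp add: o_def)
    then have "compactin euclidean (A x)"
      unfolding A_def using compact by (intro image_compactin) (auto simp: compact_space_def)
    then show ?thesis by simp
  qed
  have ne: "A x \<noteq> {}" for x using one_closed by (auto simp: A_def)
  have upper: "f (act x g) \<le> m x" if "x \<in> topspace X" "g \<in> topspace G" for x g
    unfolding m_def using comp[OF that(1)] that(2)
    by (intro cSup_upper bounded_imp_bdd_above compact_imp_bounded) (auto simp: A_def)
  have attained: "\<exists>g \<in> topspace G. m x = f (act x g)" if "x \<in> topspace X" for x
  proof -
    have "m x \<in> A x"
      unfolding m_def
      by (intro closed_contains_Sup compact_imp_closed comp that ne bounded_imp_bdd_above compact_imp_bounded)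
    then show ?thesis by (auto simp: A_def)
  qed
  have "continuous_map X euclidean m"
    unfolding continuous_map_upper_lower_semicontinuous_lt
  proof (intro conjI allI)
    fix a
    have "openin (prod_topology X G) {z \<in> topspace (prod_topology X G). f (act (fst z) (snd z)) \<in> {a<..}}"
      by (intro openin_continuous_map_preimage[OF fact]) simp
    then have "openin X (fst ` {z \<in> topspace (prod_topology X G). f (act (fst z) (snd z)) \<in> {a<..}})"
      using open_map_fst unfolding open_map_def by blast
    moreover have "fst ` {z \<in> topspace (prod_topology X G). f (act (fst z) (snd z)) \<in> {a<..}}
        = {x \<in> topspace X. m x > a}"
      using upper attained by (fastforce simp: image_iff)
    ultimately show "openin X {x \<in> topspace X. a < m x}" by simp
    have "closedin (prod_topology X G) {z \<in> topspace (prod_topology X G). f (act (fst z) (snd z)) \<in> {a..}}"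
      by (intro closedin_continuous_map_preimage[OF fact]) simp
    then have "closedin X (fst ` {z \<in> topspace (prod_topology X G). f (act (fst z) (snd z)) \<in> {a..}})"
      using Abstract_Topological_Spaces.closed_map_fst[OF compact] unfolding closed_map_def by blast
    moreover have "fst ` {z \<in> topspace (prod_topology X G). f (act (fst z) (snd z)) \<in> {a..}}
        = {x \<in> topspace X. m x \<ge> a}"
      using upper attained by (fastforce simp: image_iff)
    moreover have "{x \<in> topspace X. m x < a} = topspace X - {x \<in> topspace X. m x \<ge> a}" by auto
    ultimately show "openin X {x \<in> topspace X. m x < a}" by auto
  qed
  moreover have "m (act x g) = m x" if x: "x \<in> topspace X" and g: "g \<in> topspace G" for x g
  proof (rule antisym)
    have xg: "act x g \<in> topspace X" by (rule act_closed[OF x g])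
    obtain h where h: "h \<in> topspace G" "m (act x g) = f (act (act x g) h)" using attained[OF xg] by blast
    then show "m (act x g) \<le> m x" using upper[OF x mul_closed[OF g h(1)]] act_act[OF x g h(1)] by simp
    obtain h where h: "h \<in> topspace G" "m x = f (act x h)" using attained[OF x] by blast
    have "act (act x g) (mul (iv g) h) = act x h"
      using act_act[OF xg iv_closed[OF g] h(1)] act_act_iv[OF x g] by simp
    then show "m x \<le> m (act x g)"
      using upper[OF xg mul_closed[OF iv_closed[OF g] h(1)]] h by simp
  qed
  moreover have bounds: "0 \<le> m x \<and> m x \<le> 1" if "x \<in> topspace X" for x
    using attained[OF that] f01 act_closed[OF that] by auto
  moreover have "m x0 = 1"
    using upper[OF x0X one_closed] bounds[OF x0X] act_one[OF x0X] f'(2) by (simp add: f_def)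
  moreover have "m x = 0" if x: "x \<in> topspace X - U" for x
  proof -
    obtain g where g: "g \<in> topspace G" "m x = f (act x g)" using attained x by blast
    have "act x g \<notin> U"
      using inv[of "act x g" "iv g"] act_act_iv[of x g] iv_closed g x by auto
    then have "f' (act x g) = 1" using f'(3) act_closed[of x g] g x by auto
    then show ?thesis using g by (simp add: f_def)
  qed
  ultimately show ?thesis using that by blast
qed

end

end

section \<open>Borel constructions with contractible fibre\<close>

locale two_actions = compact_group G mul one iv
  for G :: "'g topology" and mul :: "'g \<Rightarrow> 'g \<Rightarrow> 'g" and one :: 'g and iv :: "'g \<Rightarrow> 'g" +
  fixes E :: "'e topology" and actE :: "'e \<Rightarrow> 'g \<Rightarrow> 'e"
    and X :: "'x topology" and actX :: "'x \<Rightarrow> 'g \<Rightarrow> 'x"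
  assumes actE: "continuous_right_action G mul one E actE"
    and actX: "continuous_right_action G mul one X actX"
begin

definition diagonal :: "'e \<times> 'x \<Rightarrow> 'g \<Rightarrow> 'e \<times> 'x" where
  "diagonal = (\<lambda>(e, x) g. (actE e g, actX x g))"

lemma diagonal_action: "continuous_right_action G mul one (prod_topology E X) diagonal"
  unfolding continuous_right_action_def
proof (intro conjI ballI)
  have "continuous_map (prod_topology (prod_topology E X) G) (prod_topology E X)
      (\<lambda>z. (actE (fst (fst z)) (snd z), actX (snd (fst z)) (snd z)))"
    by (intro continuous_map_pairedI continuous_map_right_action[OF actE]
        continuous_map_right_action[OF actX] continuous_map_fst_of[unfolded o_def]
        continuous_map_snd_of[unfolded o_def] continuous_map_fst continuous_map_snd
        continuous_map_compose[OF continuous_map_fst continuous_map_fst, unfolded o_def]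
        continuous_map_compose[OF continuous_map_fst continuous_map_snd, unfolded o_def])
  then show "continuous_map (prod_topology (prod_topology E X) G) (prod_topology E X)
      (\<lambda>(z, g). diagonal z g)"
    by (simp add: diagonal_def case_prod_unfold)
qed (auto simp: diagonal_def act_one[OF actE] act_one[OF actX] act_act[OF actE] act_act[OF actX])

text \<open>
  A deformation of \<open>E \<times> X\<close> over \<open>X\<close> leaves the second coordinate fixed, so only its first coordinate
  is recorded.
\<close>

definition fibrewise_deformation :: "(real \<times> 'e \<times> 'x \<Rightarrow> 'e) \<Rightarrow> bool" where
  "fibrewise_deformation D \<longleftrightarrow>
     continuous_map (prod_topology (top_of_set {0..1}) (prod_topology E X)) E D \<and>
     (\<forall>e \<in> topspace E. \<forall>x \<in> topspace X. D (0, e, x) = e) \<and>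
     (\<forall>t \<in> {0..1}. \<forall>e \<in> topspace E. \<forall>x \<in> topspace X. \<forall>g \<in> topspace G.
        D (t, actE e g, actX x g) = actE (D (t, e, x)) g)"

text \<open>
  Over \<open>W\<close> the end map of the deformation forgets the point of the fibre, and so is an equivariant section.
  The deformation itself is defined over all of \<open>X\<close>, which allows composition.
\<close>

definition shrinkable_over :: "'x set \<Rightarrow> bool" where
  "shrinkable_over W \<longleftrightarrow> (\<exists>D. fibrewise_deformation D \<and>
     (\<forall>x \<in> W. \<forall>e \<in> topspace E. \<forall>e' \<in> topspace E. D (1, e, x) = D (1, e', x)))"

lemma fibrewise_deformation_closed:
  assumes "fibrewise_deformation D" "t \<in> {0..1}" "e \<in> topspace E" "x \<in> topspace X"
  shows "D (t, e, x) \<in> topspace E"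
proof -
  have "continuous_map (prod_topology (top_of_set {0..1}) (prod_topology E X)) E D"
    using assms(1) by (simp add: fibrewise_deformation_def)
  from continuous_map_image_subset_topspace[OF this] show ?thesis using assms(2-4) by auto
qed

lemma shrinkable_over_empty: "shrinkable_over {}"
proof -
  have "continuous_map (prod_topology (top_of_set {0..1::real}) (prod_topology E X)) E (fst \<circ> snd)"
    by (intro continuous_map_compose[OF continuous_map_snd continuous_map_fst])
  then show ?thesis
    unfolding shrinkable_over_def fibrewise_deformation_def
    by (intro exI[of _ "fst \<circ> snd"]) auto
qed

text \<open>
  The two deformations are composed at every time.  Over each point of the union one of the two end maps is
  constant on the fibre, and hence so is their composite.
\<close>

lemma shrinkable_over_Un:
  assumes V: "shrinkable_over V" and W: "shrinkable_over W" and VW: "V \<union> W \<subseteq> topspace X"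
  shows "shrinkable_over (V \<union> W)"
proof -
  obtain C where C: "fibrewise_deformation C"
      "\<And>x e e'. \<lbrakk>x \<in> V; e \<in> topspace E; e' \<in> topspace E\<rbrakk> \<Longrightarrow> C (1, e, x) = C (1, e', x)"
    using V unfolding shrinkable_over_def by blast
  obtain D where D: "fibrewise_deformation D"
      "\<And>x e e'. \<lbrakk>x \<in> W; e \<in> topspace E; e' \<in> topspace E\<rbrakk> \<Longrightarrow> D (1, e, x) = D (1, e', x)"
    using W unfolding shrinkable_over_def by blast
  let ?I = "top_of_set {0..1::real}"
  define F where "F z = D (fst z, C z, snd (snd z))" for z
  have "continuous_map (prod_topology ?I (prod_topology E X)) (prod_topology ?I (prod_topology E X))
      (\<lambda>z. (fst z, C z, snd (snd z)))"
    using C(1) unfolding fibrewise_deformation_def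
    by (intro continuous_map_pairedI continuous_map_fst
        continuous_map_compose[OF continuous_map_snd continuous_map_snd, unfolded o_def]) auto
  from continuous_map_compose[OF this, of E D] D(1)
  have cont: "continuous_map (prod_topology ?I (prod_topology E X)) E F"
    unfolding fibrewise_deformation_def F_def by (simp add: o_def)
  have "fibrewise_deformation F"
    unfolding fibrewise_deformation_def
  proof (intro conjI ballI cont)
    fix e x assume ex: "e \<in> topspace E" "x \<in> topspace X"
    then show "F (0, e, x) = e"
      using C(1) D(1) unfolding fibrewise_deformation_def F_def by simp
    fix t :: real and g assume t: "t \<in> {0..1}" and g: "g \<in> topspace G"
    have "C (t, actE e g, actX x g) = actE (C (t, e, x)) g"
      using C(1) ex g t unfolding fibrewise_deformation_def by blast
    moreover have "D (t, actE (C (t, e, x)) g, actX x g) = actE (D (t, C (t, e, x), x)) g"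
      using D(1) fibrewise_deformation_closed[OF C(1) t ex] ex g t
      unfolding fibrewise_deformation_def by blast
    ultimately show "F (t, actE e g, actX x g) = actE (F (t, e, x)) g"
      by (simp add: F_def)
  qed
  moreover have "F (1, e, x) = F (1, e', x)"
    if "x \<in> V \<union> W" "e \<in> topspace E" "e' \<in> topspace E" for x e e'
  proof (cases "x \<in> V")
    case True
    then show ?thesis using C(2)[OF True that(2,3)] by (simp add: F_def)
  next
    case False
    then have x: "x \<in> W" "x \<in> topspace X" using that VW by auto
    have "C (1, e, x) \<in> topspace E" "C (1, e', x) \<in> topspace E"
      using that by (auto intro: fibrewise_deformation_closed[OF C(1) _ _ x(2)])
    then show ?thesis
      unfolding F_def fst_conv snd_conv by (rule D(2)[OF x(1)])
  qed
  ultimately show ?thesis unfolding shrinkable_over_def by blast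
qed

text \<open>
  On \<open>U\<close> the contraction of \<open>E\<close> is transported to the fibre over \<open>x\<close> by \<open>h x\<close>, which makes it
  equivariant; multiplying the time by an invariant cutoff function makes it stationary near the complement of
  \<open>U\<close>.
\<close>

lemma locally_shrinkable:
  assumes E: "contractible_space E"
    and X: "completely_regular_space X"
    and U: "openin X U" and x0: "x0 \<in> U"
    and inv: "\<And>x g. \<lbrakk>x \<in> U; g \<in> topspace G\<rbrakk> \<Longrightarrow> actX x g \<in> U"
    and h: "continuous_map (subtopology X U) G h"
    and equi: "\<And>x g. \<lbrakk>x \<in> U; g \<in> topspace G\<rbrakk> \<Longrightarrow> h (actX x g) = mul (h x) g"
  shows "\<exists>V. openin X V \<and> x0 \<in> V \<and> shrinkable_over V"
proof -
  let ?I = "top_of_set {0..1::real}"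
  let ?P = "prod_topology ?I (prod_topology E X)"
  have UX: "U \<subseteq> topspace X" by (rule openin_subset[OF U])
  have hG: "h x \<in> topspace G" if "x \<in> U" for x
    using continuous_map_image_subset_topspace[OF h] that UX by auto
  obtain a c where c: "continuous_map (prod_topology ?I E) E c"
      "\<And>e. c (0, e) = e" "\<And>e. c (1, e) = a"
    using E unfolding contractible_space_def homotopic_with_def by auto
  obtain m :: "'x \<Rightarrow> real" where m: "continuous_map X euclidean m"
    "\<And>x g. \<lbrakk>x \<in> topspace X; g \<in> topspace G\<rbrakk> \<Longrightarrow> m (actX x g) = m x"
    "m x0 = 1" "\<And>x. x \<in> topspace X \<Longrightarrow> 0 \<le> m x \<and> m x \<le> 1"
    "\<And>x. x \<in> topspace X - U \<Longrightarrow> m x = 0"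
    using invariant_bump_function[OF actX X U x0 inv] by blast
  \<comment> \<open>The cutoff is 1 where \<open>m \<ge> 2/3\<close> and 0 where \<open>m \<le> 1/3\<close>, so that the deformation is stationary
    on an open neighbourhood \<open>T\<close> of the complement of \<open>U\<close>.\<close>
  define s where "s x = max 0 (min 1 (3 * m x - 1))" for x
  have s01: "s x \<in> {0..1}" for x by (simp add: s_def)
  have s: "continuous_map X euclidean s"
    unfolding s_def by (intro continuous_intros m(1)) auto
  define L where "L z = actE (c (fst z * s (snd (snd z)), actE (fst (snd z)) (iv (h (snd (snd z))))))
     (h (snd (snd z)))" for z
  define D where "D z = (if snd (snd z) \<in> U then L z else fst (snd z))" for z
  define T where "T = {x \<in> topspace X. m x < 1/3}"
  have T: "openin X T"
    unfolding T_def using m(1) unfolding continuous_map_upper_lower_semicontinuous_lt by blast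
  have sT: "s x = 0" if "x \<in> T" for x
  proof -
    have "m x < 1/3" using that by (simp add: T_def)
    then have "3 * m x - 1 < 0" by linarith
    then show ?thesis by (simp add: s_def)
  qed
  have LT: "L (t, e, x) = e" if "x \<in> U" "x \<in> T" "e \<in> topspace E" for t e x
    using that hG[OF that(1)] by (simp add: L_def sT c(2) act_iv_act[OF actE])
  have third: "continuous_map ?P X (\<lambda>z. snd (snd z))"
    by (rule continuous_map_compose[OF continuous_map_snd continuous_map_snd, unfolded o_def])
  have second: "continuous_map ?P E (\<lambda>z. fst (snd z))"
    by (rule continuous_map_compose[OF continuous_map_snd continuous_map_fst, unfolded o_def])
  define over where "over W = {z \<in> topspace ?P. snd (snd z) \<in> W}" for W
  have over: "openin ?P (over W)" if "openin X W" for W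
    unfolding over_def by (rule openin_continuous_map_preimage[OF third that])
  have L: "continuous_map (subtopology ?P (over U)) E L"
    unfolding L_def
  proof (rule continuous_map_right_action[OF actE])
    have "continuous_map (subtopology ?P (over U)) (subtopology X U) (\<lambda>z. snd (snd z))"
      using continuous_map_from_subtopology[OF third]
      by (auto simp: continuous_map_in_subtopology over_def)
    from continuous_map_compose[OF this h]
    show hz: "continuous_map (subtopology ?P (over U)) G (\<lambda>z. h (snd (snd z)))"
      by (simp add: o_def)
    have "continuous_map (subtopology ?P (over U)) euclidean (\<lambda>z. fst z * s (snd (snd z)))"
    proof (intro continuous_map_real_mult continuous_map_from_subtopology)
      show "continuous_map ?P euclideanreal fst"
        using continuous_map_fst[of ?I "prod_topology E X"] by (simp add: continuous_map_in_subtopology)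
      show "continuous_map ?P euclideanreal (\<lambda>z. s (snd (snd z)))"
        using continuous_map_compose[OF third s] by (simp add: o_def)
    qed
    moreover have "fst z * s (snd (snd z)) \<in> {0..1}" if "z \<in> topspace ?P" for z
      using that s01[of "snd (snd z)"] by (auto simp: mult_le_one)
    ultimately have "continuous_map (subtopology ?P (over U)) ?I (\<lambda>z. fst z * s (snd (snd z)))"
      unfolding continuous_map_in_subtopology by auto
    then have "continuous_map (subtopology ?P (over U)) (prod_topology ?I E)
      (\<lambda>z. (fst z * s (snd (snd z)), actE (fst (snd z)) (iv (h (snd (snd z))))))"
      using continuous_map_compose[OF hz continuous_iv]
      by (intro continuous_map_pairedI continuous_map_right_action[OF actE]
          continuous_map_from_subtopology[OF second]) (simp_all add: o_def)
    from continuous_map_compose[OF this c(1)]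
    show "continuous_map (subtopology ?P (over U)) E
        (\<lambda>z. c (fst z * s (snd (snd z)), actE (fst (snd z)) (iv (h (snd (snd z))))))"
      by (simp add: o_def)
  qed
  have cont: "continuous_map ?P E D"
  proof (rule pasting_lemma[where I = "UNIV :: bool set" and T = "\<lambda>b. if b then over U else over T"
        and f = "\<lambda>b. if b then L else (\<lambda>z. fst (snd z))"])
    show "openin ?P (if b then over U else over T)" for b
      using U T over by simp
    show "continuous_map (subtopology ?P (if b then over U else over T)) E
        (if b then L else (\<lambda>z. fst (snd z)))" for b
      using L continuous_map_from_subtopology[OF second] by simp
    show "(if i then L else (\<lambda>z. fst (snd z))) z = (if j then L else (\<lambda>z. fst (snd z))) z"
      if "z \<in> topspace ?P \<inter> (if i then over U else over T) \<inter> (if j then over U else over T)" for i j z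
      using that by (cases z) (auto simp: over_def LT split: if_splits)
    show "\<exists>j. j \<in> UNIV \<and> z \<in> (if j then over U else over T) \<and>
        D z = (if j then L else (\<lambda>z. fst (snd z))) z" if z: "z \<in> topspace ?P" for z
    proof (cases "snd (snd z) \<in> U")
      case True
      then show ?thesis using z by (intro exI[of _ True]) (simp add: D_def over_def)
    next
      case False
      then have "snd (snd z) \<in> T" using z m(5) by (auto simp: T_def)
      then show ?thesis using False z by (intro exI[of _ False]) (simp add: D_def over_def)
    qed
  qed
  have "fibrewise_deformation D"
    unfolding fibrewise_deformation_def
  proof (intro conjI ballI cont)
    fix e x assume ex: "e \<in> topspace E" "x \<in> topspace X"
    then show "D (0, e, x) = e"
      by (auto simp: D_def L_def c(2) hG act_iv_act[OF actE])
    fix t :: real and g assume t: "t \<in> {0..1}" and g: "g \<in> topspace G"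
    show "D (t, actE e g, actX x g) = actE (D (t, e, x)) g"
    proof (cases "x \<in> U")
      case True
      have sg: "s (actX x g) = s x" using m(2)[OF ex(2) g] by (simp add: s_def)
      have "actE (actE e g) (iv (mul (h x) g)) = actE e (iv (h x))"
        using hG[OF True] g ex
        by (simp add: act_act[OF actE] iv_closed mul_closed mul_iv_mul_cancel)
      moreover have "c (t * s x, actE e (iv (h x))) \<in> topspace E"
      proof -
        have "t * s x \<in> {0..1}" using t s01[of x] by (auto simp: mult_le_one)
        moreover have "actE e (iv (h x)) \<in> topspace E"
          using ex hG[OF True] by (intro act_closed[OF actE] iv_closed)
        ultimately show ?thesis using continuous_map_image_subset_topspace[OF c(1)] by auto
      qed
      ultimately show ?thesis
        using True inv[OF True g] hG[OF True] g
        by (simp add: D_def L_def equi sg act_act[OF actE])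
    next
      case False
      have "actX x g \<notin> U"
        using inv[of "actX x g" "iv g"] act_act_iv[OF actX ex(2) g] iv_closed[OF g] False by auto
      then show ?thesis using False by (simp add: D_def)
    qed
  qed
  moreover define V where "V = {x \<in> topspace X. m x > 2/3}"
  have "D (1, e, x) = actE a (h x)" if "x \<in> V" for e x
  proof -
    have x: "x \<in> U" "s x = 1" using that m(5)[of x] by (auto simp: V_def s_def)
    then show ?thesis by (simp add: D_def L_def c(3))
  qed
  ultimately have "shrinkable_over V" unfolding shrinkable_over_def by (metis)
  moreover have "openin X V"
    unfolding V_def using m(1) unfolding continuous_map_upper_lower_semicontinuous_lt by blast
  moreover have "x0 \<in> V" using x0 UX m(3) by (auto simp: V_def)
  ultimately show ?thesis by blast
qed

lemma shrinkable_over_compact: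
  assumes X: "compact_space X"
    and loc: "\<And>x. x \<in> topspace X \<Longrightarrow> \<exists>V. openin X V \<and> x \<in> V \<and> shrinkable_over V"
  shows "shrinkable_over (topspace X)"
proof -
  let ?\<V> = "{V. openin X V \<and> shrinkable_over V}"
  have "topspace X \<subseteq> \<Union>?\<V>" using loc by blast
  then obtain \<F> where F: "finite \<F>" "\<F> \<subseteq> ?\<V>" "topspace X \<subseteq> \<Union>\<F>"
    using X unfolding compact_space_alt by (metis (no_types, lifting) mem_Collect_eq)
  have "shrinkable_over (\<Union>\<F>)"
    using F(1,2)
  proof (induction \<F>)
    case empty
    then show ?case by (simp add: shrinkable_over_empty)
  next
    case (insert V \<F>)
    then have "\<Union>(insert V \<F>) \<subseteq> topspace X" using openin_subset by blast
    then show ?case using insert by (simp add: shrinkable_over_Un)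
  qed
  moreover have "\<Union>\<F> = topspace X" using F openin_subset by blast
  ultimately show ?thesis by simp
qed

text \<open>
  The end map of the deformation is \<open>(e, x) \<mapsto> (\<sigma> x, x)\<close> for an equivariant \<open>\<sigma>\<close>, which descends to a section
  of the projection to \<open>B\<close>; the deformation descends to a homotopy from the identity to the section after the
  projection.
\<close>

theorem borel_construction_homotopy_equivalent:
  assumes shrink: "shrinkable_over (topspace X)" and ne: "topspace E \<noteq> {}"
    and q: "quotient_map X B q"
    and fib: "\<And>x y. \<lbrakk>x \<in> topspace X; y \<in> topspace X\<rbrakk> \<Longrightarrow>
      q x = q y \<longleftrightarrow> (\<exists>g \<in> topspace G. y = actX x g)"
  shows "orbit_space (prod_topology E X) diagonal (topspace G) homotopy_equivalent_space B"
proof -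
  let ?I = "top_of_set {0..1::real}"
  let ?EX = "prod_topology E X"
  let ?H = "orbit_space ?EX diagonal (topspace G)"
  let ?o = "orbit diagonal (topspace G)"
  obtain D where D1: "fibrewise_deformation D"
    and D2: "\<forall>x \<in> topspace X. \<forall>e \<in> topspace E. \<forall>e' \<in> topspace E. D (1, e, x) = D (1, e', x)"
    using shrink unfolding shrinkable_over_def by (elim exE conjE) (rule that)
  note D = D1 D2[rule_format]
  have Dcont: "continuous_map (prod_topology ?I ?EX) E D"
    and D0: "\<And>e x. \<lbrakk>e \<in> topspace E; x \<in> topspace X\<rbrakk> \<Longrightarrow> D (0, e, x) = e"
    and Dequi: "\<And>t e x g. \<lbrakk>t \<in> {0..1}; e \<in> topspace E; x \<in> topspace X; g \<in> topspace G\<rbrakk> \<Longrightarrow>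
        D (t, actE e g, actX x g) = actE (D (t, e, x)) g"
    using D(1) unfolding fibrewise_deformation_def by auto
  obtain e0 where e0: "e0 \<in> topspace E" using ne by blast
  define \<sigma> where "\<sigma> x = D (1, e0, x)" for x
  note DE = fibrewise_deformation_closed[OF D(1)]
  have \<sigma>E: "\<sigma> x \<in> topspace E" if "x \<in> topspace X" for x
    unfolding \<sigma>_def by (rule DE) (use e0 that in auto)
  have \<sigma>equi: "\<sigma> (actX x g) = actE (\<sigma> x) g" if "x \<in> topspace X" "g \<in> topspace G" for x g
    using D(2)[OF act_closed[OF actX that] e0 act_closed[OF actE e0 that(2)]]
      Dequi[OF _ e0 that, of 1] by (simp add: \<sigma>_def)
  have orb: "quotient_map ?EX ?H ?o" by (rule quotient_map_orbit[OF diagonal_action])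
  have oeq: "?o z = ?o z' \<longleftrightarrow> (\<exists>g \<in> topspace G. z' = diagonal z g)"
    if "z \<in> topspace ?EX" "z' \<in> topspace ?EX" for z z'
    by (rule orbit_eq_iff[OF diagonal_action that])
  have oact: "?o (actE e g, actX x g) = ?o (e, x)"
    if "e \<in> topspace E" "x \<in> topspace X" "g \<in> topspace G" for e x g
  proof -
    have "?o (e, x) = ?o (actE e g, actX x g)"
      using that by (subst oeq) (auto simp: diagonal_def intro: act_closed[OF actE] act_closed[OF actX])
    then show ?thesis by simp
  qed
  have "\<exists>p. continuous_map ?H B p \<and> (\<forall>z \<in> topspace ?EX. p (?o z) = q (snd z))"
  proof (rule quotient_map_lift_exists[OF orb, of B "\<lambda>z. q (snd z)"])
    show "continuous_map ?EX B (\<lambda>z. q (snd z))"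
      using continuous_map_compose[OF continuous_map_snd quotient_imp_continuous_map[OF q]]
      by (simp add: o_def)
    show "q (snd z) = q (snd z')"
      if z: "z \<in> topspace ?EX" "z' \<in> topspace ?EX" "?o z = ?o z'" for z z'
    proof -
      obtain g where "g \<in> topspace G" "z' = diagonal z g" using z oeq by blast
      then have "\<exists>g \<in> topspace G. snd z' = actX (snd z) g" by (auto simp: diagonal_def case_prod_beta)
      then show ?thesis using z by (subst fib) auto
    qed
  qed blast
  then obtain p where p: "continuous_map ?H B p" "\<And>e x. \<lbrakk>e \<in> topspace E; x \<in> topspace X\<rbrakk> \<Longrightarrow> p (?o (e, x)) = q x"
    by auto
  have "\<exists>s. continuous_map B ?H s \<and> (\<forall>x \<in> topspace X. s (q x) = ?o (\<sigma> x, x))"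
  proof (rule quotient_map_lift_exists[OF q, of ?H "\<lambda>x. ?o (\<sigma> x, x)"])
    have "continuous_map X (prod_topology ?I ?EX) (\<lambda>x. (1, e0, x))"
      using e0 by (intro continuous_map_pairedI) auto
    from continuous_map_compose[OF this Dcont] have "continuous_map X E \<sigma>"
      by (simp add: o_def \<sigma>_def[abs_def])
    then have "continuous_map X ?EX (\<lambda>x. (\<sigma> x, x))"
      by (intro continuous_map_pairedI) auto
    from continuous_map_compose[OF this quotient_imp_continuous_map[OF orb]]
    show "continuous_map X ?H (\<lambda>x. ?o (\<sigma> x, x))" by (simp add: o_def)
    show "?o (\<sigma> x, x) = ?o (\<sigma> y, y)"
      if xy: "x \<in> topspace X" "y \<in> topspace X" "q x = q y" for x y
    proof -
      obtain g where "g \<in> topspace G" "y = actX x g" using xy fib by blast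
      then show ?thesis using oact[OF \<sigma>E[OF xy(1)] xy(1)] \<sigma>equi[OF xy(1)] by simp
    qed
  qed blast
  then obtain s where s: "continuous_map B ?H s" "\<And>x. x \<in> topspace X \<Longrightarrow> s (q x) = ?o (\<sigma> x, x)"
    by auto
  \<comment> \<open>The homotopy is defined on representatives, so the product of the interval with the orbit map has to be
    a quotient map; it is, because it is open.\<close>
  let ?id_o = "\<lambda>(t :: real, z). (t, ?o z)"
  have id_o: "quotient_map (prod_topology ?I ?EX) (prod_topology ?I ?H) ?id_o"
  proof (rule continuous_open_imp_quotient_map)
    show "continuous_map (prod_topology ?I ?EX) (prod_topology ?I ?H) ?id_o"
      unfolding case_prod_unfold
      by (intro continuous_map_pairedI continuous_map_fst
          continuous_map_compose[OF continuous_map_snd quotient_imp_continuous_map[OF orb], unfolded o_def])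
    show "?id_o ` topspace (prod_topology ?I ?EX) = topspace (prod_topology ?I ?H)"
    proof -
      have "?id_o ` ({0..1} \<times> topspace ?EX) = {0..1} \<times> ?o ` topspace ?EX" by auto
      then show ?thesis unfolding quotient_imp_surjective_map[OF orb] by simp
    qed
    show "open_map (prod_topology ?I ?EX) (prod_topology ?I ?H) ?id_o"
      unfolding open_map_def
    proof (intro allI impI)
      fix W assume W: "openin (prod_topology ?I ?EX) W"
      show "openin (prod_topology ?I ?H) (?id_o ` W)"
        unfolding openin_prod_topology_alt
      proof (intro allI impI)
        fix t y assume "(t, y) \<in> ?id_o ` W"
        then obtain w where "w \<in> W" "(t, y) = ?id_o w" by (rule imageE)
        then obtain z where z: "(t, z) \<in> W" "y = ?o z" by (cases w) simp
        then obtain J V where JV: "openin ?I J" "openin ?EX V" "t \<in> J" "z \<in> V" "J \<times> V \<subseteq> W"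
          using W unfolding openin_prod_topology_alt by meson
        have "openin ?H (?o ` V)"
          using open_map_orbit[OF diagonal_action] JV(2) unfolding open_map_def by blast
        moreover have "J \<times> ?o ` V \<subseteq> ?id_o ` W"
        proof -
          have "J \<times> ?o ` V = ?id_o ` (J \<times> V)" by auto
          then show ?thesis using image_mono[OF JV(5), of ?id_o] by (rule ord_eq_le_trans)
        qed
        moreover have "y \<in> ?o ` V" unfolding z(2) using JV(4) by (rule imageI)
        ultimately show "\<exists>U V. openin ?I U \<and> openin ?H V \<and> t \<in> U \<and> y \<in> V \<and> U \<times> V \<subseteq> ?id_o ` W"
          using JV(1,3) by (intro exI[of _ J] exI[of _ "?o ` V"] conjI)
      qed
    qed
  qed
  have "\<exists>h. continuous_map (prod_topology ?I ?H) ?H h \<and>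
      (\<forall>w \<in> topspace (prod_topology ?I ?EX). h (?id_o w) = ?o (D w, snd (snd w)))"
  proof (rule quotient_map_lift_exists[OF id_o, of ?H "\<lambda>w. ?o (D w, snd (snd w))"])
    have "continuous_map (prod_topology ?I ?EX) ?EX (\<lambda>w. (D w, snd (snd w)))"
      by (intro continuous_map_pairedI Dcont
          continuous_map_compose[OF continuous_map_snd continuous_map_snd, unfolded o_def])
    from continuous_map_compose[OF this quotient_imp_continuous_map[OF orb]]
    show "continuous_map (prod_topology ?I ?EX) ?H (\<lambda>w. ?o (D w, snd (snd w)))" by (simp add: o_def)
    fix w w' assume w: "w \<in> topspace (prod_topology ?I ?EX)" "w' \<in> topspace (prod_topology ?I ?EX)"
        "?id_o w = ?id_o w'"
    obtain t e x where wt: "w = (t, e, x)" by (cases w) auto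
    obtain z' where w't: "w' = (t, z')" using w(3) wt by (cases w') auto
    have tex: "t \<in> {0..1}" "e \<in> topspace E" "x \<in> topspace X" using w(1) wt by auto
    obtain g where g: "g \<in> topspace G" "z' = diagonal (e, x) g"
      using w wt w't oeq by auto
    then have "?o (D w', snd (snd w')) = ?o (actE (D (t, e, x)) g, actX x g)"
      using Dequi[OF tex g(1)] by (simp add: w't diagonal_def)
    then show "?o (D w, snd (snd w)) = ?o (D w', snd (snd w'))"
      using oact[OF DE[OF tex] tex(3) g(1)] by (simp add: wt)
  qed blast
  then obtain h where h: "continuous_map (prod_topology ?I ?H) ?H h"
    "\<And>t e x. \<lbrakk>t \<in> {0..1}; e \<in> topspace E; x \<in> topspace X\<rbrakk> \<Longrightarrow> h (t, ?o (e, x)) = ?o (D (t, e, x), x)"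
    by auto
  have Hrep: "\<exists>e x. e \<in> topspace E \<and> x \<in> topspace X \<and> y = ?o (e, x)" if "y \<in> topspace ?H" for y
  proof -
    have "y \<in> ?o ` topspace ?EX" using that by (simp only: quotient_imp_surjective_map[OF orb])
    then show ?thesis by auto
  qed
  have "homotopic_with (\<lambda>_. True) ?H ?H id (s \<circ> p)"
  proof (rule homotopic_with[THEN iffD2], rule refl, intro exI[of _ h] conjI ballI h(1) TrueI)
    fix y assume "y \<in> topspace ?H"
    then obtain e x where ex: "e \<in> topspace E" "x \<in> topspace X" "y = ?o (e, x)" using Hrep by blast
    then show "h (0, y) = id y" using h(2)[of 0 e x] D0 by simp
    show "h (1, y) = (s \<circ> p) y"
      using h(2)[of 1 e x] D(2)[OF ex(2) e0 ex(1)] ex p(2) s(2) by (simp add: \<sigma>_def)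
  qed
  then have "homotopic_with (\<lambda>_. True) ?H ?H (s \<circ> p) id" by (rule homotopic_with_symD)
  moreover have "homotopic_with (\<lambda>_. True) B B (p \<circ> s) id"
  proof (rule homotopic_with_equal)
    show "continuous_map B B (p \<circ> s)" by (rule continuous_map_compose[OF s(1) p(1)])
    fix b assume "b \<in> topspace B"
    then obtain x where "x \<in> topspace X" "b = q x" using quotient_imp_surjective_map[OF q] by blast
    then show "(p \<circ> s) b = id b" using p(2) s(2) \<sigma>E by simp
  qed simp_all
  ultimately show ?thesis unfolding homotopy_equivalent_space_def using p(1) s(1) by blast
qed

end

section \<open>Matrix units and the Hermitian inner product\<close>

text \<open>
  The Hermitian inner product, conjugate linear in the first argument; its real part is the inner product of
  the type class.
\<close>

definition cinner :: "complex ^ 'n::finite \<Rightarrow> complex ^ 'n \<Rightarrow> complex" where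
  "cinner x y = (\<Sum>i\<in>UNIV. cnj (x $ i) * y $ i)"

text \<open>
  The rank one operator \<open>x y\<^sup>*\<close>.
\<close>

definition outer :: "complex ^ 'm::finite \<Rightarrow> complex ^ 'n::finite \<Rightarrow> complex ^ 'n ^ 'm" where
  "outer x y = (\<chi> i j. x $ i * cnj (y $ j))"

definition unit_matrix :: "'n::finite \<Rightarrow> 'n \<Rightarrow> 'n cmat" where
  "unit_matrix i j = outer (axis i 1) (axis j 1)"

lemma cinner_self: "cinner x x = of_real ((norm x)\<^sup>2)"
proof -
  have "(norm x)\<^sup>2 = (\<Sum>i\<in>UNIV. (cmod (x $ i))\<^sup>2)"
    by (simp add: norm_vec_def L2_set_def sum_nonneg)
  then show ?thesis
    by (simp add: cinner_def complex_norm_square mult.commute del: of_real_power)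
qed

lemma cinner_commute: "cinner y x = cnj (cinner x y)"
  by (simp add: cinner_def mult.commute)

lemma cinner_add_right: "cinner x (y + z) = cinner x y + cinner x z"
  by (simp add: cinner_def algebra_simps sum.distrib)

lemma cinner_diff_right: "cinner x (y - z) = cinner x y - cinner x z"
  by (simp add: cinner_def algebra_simps sum_subtractf)

lemma cinner_scale_right: "cinner x (c *s y) = c * cinner x y"
  by (simp add: cinner_def sum_distrib_left mult_ac)

lemma cinner_scale_left: "cinner (c *s x) y = cnj c * cinner x y"
  by (simp add: cinner_def sum_distrib_left mult_ac)

lemma cinner_sum_right: "cinner x (\<Sum>i\<in>S. f i) = (\<Sum>i\<in>S. cinner x (f i))"
  by (induction S rule: infinite_finite_induct) (simp_all add: cinner_add_right, simp_all add: cinner_def)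

lemma cinner_axis: "cinner (axis i 1) x = x $ i"
  by (simp add: cinner_def axis_def if_distrib[of cnj] if_distrib[of "\<lambda>c. c * _"] cong: if_cong)

lemma norm_axis_complex: "norm (axis i 1 :: complex ^ 'n::finite) = 1"
proof -
  have "complex_of_real ((norm (axis i 1 :: complex ^ 'n))\<^sup>2) = 1"
    unfolding cinner_self[symmetric] cinner_axis by (simp add: axis_def)
  then have "(norm (axis i 1 :: complex ^ 'n))\<^sup>2 = 1" by (simp only: of_real_eq_1_iff)
  then show ?thesis by (simp add: power2_eq_1_iff)
qed

lemma matrix_vector_axis_nth: "((a :: complex ^ 'n::finite ^ 'm::finite) *v axis j 1) $ i = a $ i $ j"
  by (simp add: matrix_vector_mult_def axis_def if_distrib[of "\<lambda>c. _ * c"] cong: if_cong)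

lemma matrix_nth_eq_cinner: "(a :: 'n::finite cmat) $ i $ j = cinner (axis i 1) (a *v axis j 1)"
  by (simp add: cinner_axis matrix_vector_axis_nth)

lemma matrix_diff_rdistrib: "((a :: complex ^ 'n::finite ^ 'm::finite) - b) ** c = a ** c - b ** c"
  by (simp add: matrix_matrix_mult_def vec_eq_iff algebra_simps sum_subtractf)

lemma matrix_diff_ldistrib: "(c :: complex ^ 'n::finite ^ 'm::finite) ** (a - b) = c ** a - c ** b"
  by (simp add: matrix_matrix_mult_def vec_eq_iff algebra_simps sum_subtractf)

lemma cinner_adjoint: "cinner (a *v x) y = cinner x (star a *v y)"
proof -
  have "cinner (a *v x) y = (\<Sum>i\<in>UNIV. \<Sum>j\<in>UNIV. cnj (a $ i $ j) * cnj (x $ j) * y $ i)"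
    by (simp add: cinner_def matrix_vector_mult_def sum_distrib_right)
  also have "\<dots> = (\<Sum>j\<in>UNIV. \<Sum>i\<in>UNIV. cnj (a $ i $ j) * cnj (x $ j) * y $ i)"
    by (rule sum.swap)
  also have "\<dots> = cinner x (star a *v y)"
    by (simp add: cinner_def matrix_vector_mult_def star_def sum_distrib_left mult_ac)
  finally show ?thesis .
qed

lemma norm_cscale_vec: "norm (c *s (x :: complex ^ 'n::finite)) = cmod c * norm x"
  by (simp add: norm_vec_def norm_mult L2_set_right_distrib)

lemma mult_outer: "a ** outer x y = outer (a *v x) y"
  by (simp add: outer_def matrix_matrix_mult_def matrix_vector_mult_def vec_eq_iff sum_distrib_left mult_ac)

lemma outer_mult: "outer x y ** a = outer x (star a *v y)"
  by (simp add: outer_def matrix_matrix_mult_def matrix_vector_mult_def star_def vec_eq_iff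
      sum_distrib_left mult_ac)

lemma outer_vec: "outer x y *v z = cinner y z *s x"
  by (simp add: outer_def matrix_vector_mult_def cinner_def vec_eq_iff sum_distrib_left sum_distrib_right mult_ac)

lemma outer_outer: "outer x y ** outer z w = cscale (cinner y z) (outer x w)"
  by (simp add: outer_def matrix_matrix_mult_def cinner_def cscale_def vec_eq_iff
      sum_distrib_left sum_distrib_right mult_ac)

lemma star_outer: "star (outer x y) = outer y x"
  by (simp add: star_def outer_def vec_eq_iff mult.commute)

lemma trace_outer: "trace (outer x y) = cinner y x"
  by (simp add: trace_def outer_def cinner_def mult.commute)

lemma trace_cscale: "trace (cscale c a) = c * trace a"
  by (simp add: trace_def cscale_def sum_distrib_left)

lemma cscale_diff: "cscale c (a - b) = cscale c a - cscale c b"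
  by (simp add: cscale_def vec_eq_iff algebra_simps)

lemma trace_sum: "trace (\<Sum>i\<in>S. f i) = (\<Sum>i\<in>S. trace (f i :: 'n::finite cmat))"
  unfolding trace_def sum_component by (rule sum.swap)

lemma trace_star: "trace (star a) = cnj (trace a)"
  by (simp add: trace_def star_def)

lemma trace_kron: "trace (kron a b) = trace a * trace b"
  by (simp add: trace_def kron_def sum_product sum.cartesian_product case_prod_unfold)

lemma outer_add_left: "outer (x + y) z = outer x z + outer y z"
  by (simp add: outer_def vec_eq_iff algebra_simps)

lemma outer_add_right: "outer z (x + y) = outer z x + outer z y"
  by (simp add: outer_def vec_eq_iff algebra_simps)

lemma outer_diff_left: "outer (x - y) z = outer x z - outer y z"
  by (simp add: outer_def vec_eq_iff algebra_simps)

lemma outer_diff_right: "outer z (x - y) = outer z x - outer z y"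
  by (simp add: outer_def vec_eq_iff algebra_simps)

lemma outer_scale_left: "outer (c *s x) y = cscale c (outer x y)"
  by (simp add: outer_def cscale_def vec_eq_iff mult_ac)

lemma outer_scale_right: "outer x (c *s y) = cscale (cnj c) (outer x y)"
  by (simp add: outer_def cscale_def vec_eq_iff mult_ac)

lemma unit_matrix_nth: "unit_matrix i j $ p $ q = (if p = i \<and> q = j then 1 else 0)"
  by (auto simp: unit_matrix_def outer_def axis_def)

lemma matrix_eq_sum_units: "a = (\<Sum>i\<in>UNIV. \<Sum>j\<in>UNIV. cscale (a $ i $ j) (unit_matrix i j))"
proof -
  have "(\<Sum>i\<in>UNIV. \<Sum>j\<in>UNIV. cscale (a $ i $ j) (unit_matrix i j)) $ p $ q = a $ p $ q" for p q
  proof -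
    have "(\<Sum>i\<in>UNIV. \<Sum>j\<in>UNIV. cscale (a $ i $ j) (unit_matrix i j)) $ p $ q
        = (\<Sum>i\<in>UNIV. \<Sum>j\<in>UNIV. if p = i then if q = j then a $ i $ j else 0 else 0)"
      unfolding sum_component
      by (intro sum.cong refl) (simp add: cscale_def unit_matrix_nth)
    also have "\<dots> = (\<Sum>i\<in>UNIV. if p = i then a $ i $ q else 0)"
      by (intro sum.cong refl) simp
    finally show ?thesis by simp
  qed
  then show ?thesis by (simp add: vec_eq_iff)
qed

lemma unit_matrix_mult:
  "unit_matrix i j ** unit_matrix p q = (if j = p then unit_matrix i q else 0)"
  by (simp add: unit_matrix_def outer_outer cinner_axis) (auto simp: axis_def cscale_def vec_eq_iff)

lemma star_unit_matrix: "star (unit_matrix i j) = unit_matrix j i"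
  by (simp add: unit_matrix_def star_outer)

lemma sum_unit_matrix: "(\<Sum>i\<in>UNIV. unit_matrix i i) = mat 1"
proof -
  have "(\<Sum>i\<in>UNIV. unit_matrix i i) $ p $ q = (mat 1 :: 'a cmat) $ p $ q" for p q
  proof -
    have "(\<Sum>i\<in>UNIV. unit_matrix i i) $ p $ q = (\<Sum>i\<in>UNIV. if p = i then if p = q then 1 else 0 else (0::complex))"
      unfolding sum_component
      by (intro sum.cong refl) (auto simp: unit_matrix_nth)
    then show ?thesis by (simp add: mat_def)
  qed
  then show ?thesis by (simp add: vec_eq_iff)
qed

lemma mult_unit_matrix: "a ** unit_matrix j p = (\<Sum>i\<in>UNIV. cscale (a $ i $ j) (unit_matrix i p))"
proof -
  have "(a ** unit_matrix j p) $ r $ q = (\<Sum>i\<in>UNIV. cscale (a $ i $ j) (unit_matrix i p)) $ r $ q" for r q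
  proof -
    have "(\<Sum>i\<in>UNIV. cscale (a $ i $ j) (unit_matrix i p)) $ r $ q
        = (\<Sum>i\<in>UNIV. if r = i then if q = p then a $ i $ j else 0 else 0)"
      unfolding sum_component by (intro sum.cong refl) (auto simp: cscale_def unit_matrix_nth)
    also have "\<dots> = (if q = p then a $ r $ j else 0)" by simp
    also have "\<dots> = (a ** unit_matrix j p) $ r $ q"
    proof -
      have "(a ** unit_matrix j p) $ r $ q = (\<Sum>k\<in>UNIV. if k = j then if q = p then a $ r $ k else 0 else 0)"
        unfolding matrix_matrix_mult_def vec_lambda_beta
        by (intro sum.cong refl) (simp add: unit_matrix_nth)
      then show ?thesis by simp
    qed
    finally show ?thesis by simp
  qed
  then show ?thesis by (simp add: vec_eq_iff)
qed

section \<open>Unital star homomorphisms of matrix algebras\<close>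

lemma
  assumes "unital_star_hom \<phi>"
  shows unital_star_hom_add: "\<phi> (a + b) = \<phi> a + \<phi> b"
    and unital_star_hom_cscale: "\<phi> (cscale c a) = cscale c (\<phi> a)"
    and unital_star_hom_mult: "\<phi> (a ** b) = \<phi> a ** \<phi> b"
    and unital_star_hom_star: "\<phi> (star a) = star (\<phi> a)"
    and unital_star_hom_one: "\<phi> (mat 1) = mat 1"
  using assms by (auto simp: unital_star_hom_def)

lemma unital_star_hom_zero: "unital_star_hom \<phi> \<Longrightarrow> \<phi> 0 = 0"
  using unital_star_hom_add[of \<phi> 0 0] by simp

lemma unital_star_hom_sum:
  assumes "unital_star_hom \<phi>"
  shows "\<phi> (\<Sum>i\<in>S. f i) = (\<Sum>i\<in>S. \<phi> (f i))"
  by (induction S rule: infinite_finite_induct)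
     (simp_all add: unital_star_hom_zero[OF assms] unital_star_hom_add[OF assms])

lemma unital_star_hom_diff:
  assumes "unital_star_hom \<phi>"
  shows "\<phi> (a - b) = \<phi> a - \<phi> b"
proof -
  have "\<phi> (a - b) + \<phi> b = \<phi> a" unfolding unital_star_hom_add[OF assms, symmetric] by simp
  then show ?thesis by (simp add: algebra_simps)
qed

lemma unital_star_hom_eq_sum_units:
  assumes "unital_star_hom \<phi>"
  shows "\<phi> a = (\<Sum>i\<in>UNIV. \<Sum>j\<in>UNIV. cscale (a $ i $ j) (\<phi> (unit_matrix i j)))"
  by (subst matrix_eq_sum_units) (simp add: unital_star_hom_sum[OF assms] unital_star_hom_cscale[OF assms])

text \<open>
  As long as fewer than \<open>N\<close> vectors have been found, subtracting their rank one projections from \<open>p\<close>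
  leaves a matrix of nonzero trace; any nonzero column of it lies in the range of \<open>p\<close>, is orthogonal to the
  vectors found, and can be normalized.
\<close>

lemma projection_orthonormal_family:
  fixes p :: "'n::finite cmat"
  assumes p: "star p = p" "p ** p = p" and tr: "trace p = of_nat N"
  shows "m \<le> N \<Longrightarrow> \<exists>f :: nat \<Rightarrow> complex ^ 'n.
    (\<forall>i < m. \<forall>j < m. cinner (f i) (f j) = (if i = j then 1 else 0)) \<and> (\<forall>i < m. p *v f i = f i)"
proof (induction m)
  case 0
  then show ?case by simp
next
  case (Suc m)
  then obtain f :: "nat \<Rightarrow> complex ^ 'n"
    where f: "\<And>i j. \<lbrakk>i < m; j < m\<rbrakk> \<Longrightarrow> cinner (f i) (f j) = (if i = j then 1 else 0)"
      "\<And>i. i < m \<Longrightarrow> p *v f i = f i" by auto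
  define q where "q = p - (\<Sum>i<m. outer (f i) (f i))"
  have "trace q = of_nat N - of_nat m"
    by (simp add: q_def trace_sub trace_sum trace_outer f tr)
  then have "trace q \<noteq> 0" using Suc.prems by simp
  then have "q \<noteq> 0" by (auto simp: trace_def)
  then obtain i j where ij: "q $ i $ j \<noteq> 0" by (auto simp: vec_eq_iff)
  define x where "x = q *v axis j 1"
  have x: "x = p *v axis j 1 - (\<Sum>k<m. cinner (f k) (axis j 1) *s f k)"
  proof -
    have *: "(\<Sum>k\<in>S. outer (f k) (f k)) *v z = (\<Sum>k\<in>S. cinner (f k) z *s f k)" for S z
      by (induction S rule: infinite_finite_induct) (simp_all add: matrix_vector_mult_add_rdistrib outer_vec)
    show ?thesis
      by (simp add: x_def q_def matrix_vector_mult_diff_rdistrib *)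
  qed
  have "x \<noteq> 0"
  proof
    assume "x = 0"
    then have "cinner (axis i 1) x = 0" by (simp add: cinner_def)
    moreover have "cinner (axis i 1) x = q $ i $ j"
      by (simp add: matrix_nth_eq_cinner x_def)
    ultimately show False using ij by simp
  qed
  have px: "p *v x = x"
  proof -
    have *: "p *v (\<Sum>k\<in>S. g k) = (\<Sum>k\<in>S. p *v g k)" for S and g :: "nat \<Rightarrow> complex ^ 'n"
      by (induction S rule: infinite_finite_induct) (simp_all add: matrix_vector_right_distrib)
    have "p *v (\<Sum>k<m. cinner (f k) (axis j 1) *s f k) = (\<Sum>k<m. cinner (f k) (axis j 1) *s f k)"
      unfolding * by (intro sum.cong refl) (simp add: vector_scalar_commute f)
    then show ?thesis
      by (simp add: x matrix_vector_mult_diff_distrib matrix_vector_mul_assoc p)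
  qed
  have fx: "cinner (f i) x = 0" if i: "i < m" for i
  proof -
    have "cinner (f i) (p *v axis j 1) = cinner (f i) (axis j 1)"
      using cinner_adjoint[of p "f i" "axis j 1"] f(2)[OF i] p(1) by simp
    moreover have "(\<Sum>k<m. cinner (f k) (axis j 1) * cinner (f i) (f k))
        = (\<Sum>k<m. if i = k then cinner (f k) (axis j 1) else 0)"
      by (intro sum.cong refl) (simp add: f(1) i)
    ultimately show ?thesis
      using i by (simp add: x cinner_diff_right cinner_sum_right cinner_scale_right)
  qed
  define y where "y = complex_of_real (1 / norm x) *s x"
  have "norm y = 1" using \<open>x \<noteq> 0\<close> by (simp add: y_def norm_cscale_vec norm_divide)
  then have yy: "cinner y y = 1" by (simp add: cinner_self)
  have fy: "cinner (f i) y = 0" "cinner y (f i) = 0" if "i < m" for i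
  proof -
    show *: "cinner (f i) y = 0" by (simp add: y_def cinner_scale_right fx[OF that])
    show "cinner y (f i) = 0" by (subst cinner_commute) (simp add: *)
  qed
  have py: "p *v y = y" by (simp add: y_def vector_scalar_commute px)
  define g where "g = f(m := y)"
  show ?case
    by (intro exI[of _ g]) (auto simp: g_def less_Suc_eq f yy fy py)
qed

lemma projection_orthonormal_basis:
  fixes p :: "'n::finite cmat"
  assumes p: "star p = p" "p ** p = p" and tr: "trace p = of_nat (CARD('l::finite))"
  shows "\<exists>w :: 'l \<Rightarrow> complex ^ 'n.
    (\<forall>s t. cinner (w s) (w t) = (if s = t then 1 else 0)) \<and> (\<forall>s. p *v w s = w s)"
proof -
  obtain f :: "nat \<Rightarrow> complex ^ 'n"
    where f: "\<And>i j. \<lbrakk>i < CARD('l); j < CARD('l)\<rbrakk> \<Longrightarrow> cinner (f i) (f j) = (if i = j then 1 else 0)"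
      "\<And>i. i < CARD('l) \<Longrightarrow> p *v f i = f i"
    using projection_orthonormal_family[OF p tr order_refl] by blast
  obtain h :: "'l \<Rightarrow> nat" where h: "bij_betw h UNIV {0..<CARD('l)}"
    using ex_bij_betw_finite_nat[of "UNIV :: 'l set"] by auto
  then have "h s < CARD('l)" "h s = h t \<longleftrightarrow> s = t" for s t
    by (auto simp: bij_betw_def inj_on_def)
  then show ?thesis by (intro exI[of _ "f \<circ> h"]) (simp add: f)
qed

text \<open>
  The Skolem-Noether theorem with multiplicity.  All diagonal matrix units have images of equal trace,
  so the image of a fixed one is a projection of trace \<open>l\<close>.  Moving an orthonormal basis
  \<open>w\<close> of its range by the images of the matrix units \<open>e\<^sub>i\<^sub>1\<close> gives the columns of the unitary \<open>u\<close>.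
\<close>

theorem unital_star_hom_eq_Ad_kron:
  fixes \<phi> :: "'k::finite cmat \<Rightarrow> ('k \<times> 'l::finite) cmat"
  assumes \<phi>: "unital_star_hom \<phi>"
  obtains u where "u \<in> unitary" "\<phi> = Ad u \<circ> (\<lambda>a. kron a (mat 1))"
proof -
  define i0 :: 'k where "i0 = undefined"
  let ?e = "\<lambda>i j. \<phi> (unit_matrix i j)"
  let ?p = "?e i0 i0"
  have mult: "?e i j ** ?e p q = (if j = p then ?e i q else 0)" for i j p q
    by (simp add: unital_star_hom_mult[OF \<phi>, symmetric] unit_matrix_mult unital_star_hom_zero[OF \<phi>])
  have star: "star (?e i j) = ?e j i" for i j
    by (simp add: unital_star_hom_star[OF \<phi>, symmetric] star_unit_matrix)
  have same: "trace (?e i i) = trace ?p" for i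
    using trace_mul_sym[of "?e i i0" "?e i0 i"] by (simp add: mult)
  have "trace (mat 1 :: ('k \<times> 'l) cmat) = (\<Sum>i\<in>UNIV. trace (?e i i))"
  proof -
    have "(mat 1 :: ('k \<times> 'l) cmat) = (\<Sum>i\<in>UNIV. ?e i i)"
      using unital_star_hom_one[OF \<phi>]
      by (simp add: sum_unit_matrix[symmetric] unital_star_hom_sum[OF \<phi>])
    then show ?thesis by (simp only: trace_sum)
  qed
  also have "\<dots> = (\<Sum>i\<in>(UNIV :: 'k set). trace ?p)" by (rule sum.cong[OF refl same])
  finally have "of_nat (CARD('k)) * of_nat (CARD('l)) = of_nat (CARD('k)) * trace ?p"
    by (simp add: trace_I)
  then have "trace ?p = of_nat (CARD('l))" by simp
  then obtain w :: "'l \<Rightarrow> complex ^ ('k \<times> 'l)"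
    where w: "\<And>s t. cinner (w s) (w t) = (if s = t then 1 else 0)" "\<And>s. ?p *v w s = w s"
    using projection_orthonormal_basis[of ?p] by (auto simp: star mult)
  define v where "v = (\<lambda>(i, s). ?e i i0 *v w s)"
  define u :: "('k \<times> 'l) cmat" where "u = (\<chi> p q. v q $ p)"
  have "cinner (v q) (v r) = (if q = r then 1 else 0)" for q r
  proof -
    obtain i s j t where qr: "q = (i, s)" "r = (j, t)" by (cases q, cases r) auto
    have "cinner (v q) (v r) = cinner (w s) ((?e i0 i ** ?e j i0) *v w t)"
      by (simp add: qr v_def cinner_adjoint star matrix_vector_mul_assoc)
    also have "\<dots> = (if q = r then 1 else 0)"
      by (cases "i = j") (auto simp: mult w qr, simp add: cinner_def)
    finally show ?thesis .
  qed
  then have uu: "star u ** u = mat 1"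
    by (simp add: star_def u_def matrix_matrix_mult_def mat_def vec_eq_iff cinner_def)
  then have "u ** star u = mat 1" using matrix_left_right_inverse by blast
  with uu have u: "u \<in> unitary" by (simp add: unitary_def)
  have "\<phi> a ** u = u ** kron a (mat 1)" for a
  proof -
    have "(\<phi> a ** u) $ r $ (j, t) = (u ** kron a (mat 1)) $ r $ (j, t)" for r j t
    proof -
      have "(\<phi> a ** u) $ r $ (j, t) = (\<phi> a *v v (j, t)) $ r"
        by (simp add: matrix_matrix_mult_def matrix_vector_mult_def u_def)
      also have "\<phi> a *v v (j, t) = \<phi> (a ** unit_matrix j i0) *v w t"
        by (simp add: v_def matrix_vector_mul_assoc unital_star_hom_mult[OF \<phi>])
      also have "\<dots> = (\<Sum>i\<in>UNIV. a $ i $ j *s v (i, t))"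
      proof -
        have *: "(\<Sum>i\<in>S. cscale (a $ i $ j) (?e i i0)) *v w t = (\<Sum>i\<in>S. a $ i $ j *s v (i, t))" for S
        proof (induction S rule: infinite_finite_induct)
          case (insert i S)
          have "cscale (a $ i $ j) (?e i i0) *v w t = a $ i $ j *s v (i, t)"
            by (simp add: v_def cscale_def matrix_vector_mult_def vec_eq_iff sum_distrib_left mult.assoc)
          then show ?case using insert by (simp add: matrix_vector_mult_add_rdistrib)
        qed simp_all
        show ?thesis
          by (simp add: mult_unit_matrix unital_star_hom_sum[OF \<phi>] unital_star_hom_cscale[OF \<phi>] *)
      qed
      also have "(\<Sum>i\<in>UNIV. a $ i $ j *s v (i, t)) $ r = (\<Sum>i\<in>UNIV. a $ i $ j * v (i, t) $ r)"
        by (simp add: sum_component)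
      also have "\<dots> = (\<Sum>i\<in>UNIV. \<Sum>s\<in>UNIV. u $ r $ (i, s) * kron a (mat 1) $ (i, s) $ (j, t))"
        by (simp add: u_def kron_def mat_def if_distrib[of "\<lambda>c. _ * c"] mult.commute cong: if_cong)
      also have "\<dots> = (u ** kron a (mat 1)) $ r $ (j, t)"
        by (simp add: matrix_matrix_mult_def sum.cartesian_product UNIV_Times_UNIV case_prod_unfold)
      finally show ?thesis .
    qed
    then show ?thesis by (simp add: vec_eq_iff split_paired_all)
  qed
  then have "Ad u (kron a (mat 1)) = \<phi> a ** (u ** star u)" for a
    by (simp add: Ad_def matrix_mul_assoc)
  then have "\<phi> a = Ad u (kron a (mat 1))" for a
    using u by (simp add: unitary_def)
  then show ?thesis using that[OF u] by (simp add: fun_eq_iff)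
qed

text \<open>
  The case of multiplicity one: the second tensor factor is the algebra of \<open>1 \<times> 1\<close> matrices.
\<close>

lemma unital_star_endomorphism_eq_Ad:
  fixes \<alpha> :: "'k::finite cmat \<Rightarrow> 'k cmat"
  assumes "unital_star_hom \<alpha>"
  obtains g where "g \<in> unitary" "\<alpha> = Ad g"
proof -
  let ?one = "mat 1 :: unit cmat"
  have "unital_star_hom ((\<lambda>a. kron a ?one) \<circ> \<alpha>)"
    by (intro unital_star_hom_comp unital_star_hom_kron_one assms)
  then obtain u where u: "u \<in> unitary" "(\<lambda>a. kron a ?one) \<circ> \<alpha> = Ad u \<circ> (\<lambda>a. kron a ?one)"
    using unital_star_hom_eq_Ad_kron by blast
  define g :: "'k cmat" where "g = (\<chi> i j. u $ (i, ()) $ (j, ()))"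
  have ug: "u = kron g ?one" by (simp add: g_def kron_def mat_def vec_eq_iff split_paired_all)
  have inj: "kron a ?one = kron b ?one \<longleftrightarrow> a = b" for a b :: "'k cmat"
    using inj_kron_one by (auto dest: injD)
  have "g \<in> unitary"
    using u(1) inj[of _ "mat 1"] by (simp add: unitary_def ug star_kron kron_mult kron_one)
  moreover have "\<alpha> a = Ad g a" for a
    using fun_cong[OF u(2), of a] by (simp add: ug Ad_def star_kron kron_mult inj)
  ultimately show ?thesis using that by (simp add: fun_eq_iff)
qed

lemma trace_unital_star_hom:
  fixes \<phi> :: "'k::finite cmat \<Rightarrow> ('k \<times> 'l::finite) cmat"
  assumes "unital_star_hom \<phi>"
  shows "trace (\<phi> a) = of_nat (CARD('l)) * trace a"
proof -
  obtain u where u: "u \<in> unitary" "\<phi> = Ad u \<circ> (\<lambda>a. kron a (mat 1))"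
    using unital_star_hom_eq_Ad_kron[OF assms] .
  have "trace (\<phi> a) = trace (star u ** (u ** kron a (mat 1)))"
    unfolding u(2) Ad_def o_def by (rule trace_mul_sym)
  then show ?thesis
    using u(1) by (simp add: matrix_mul_assoc unitary_def trace_kron trace_I)
qed

lemma inj_unital_star_hom:
  fixes \<phi> :: "'k::finite cmat \<Rightarrow> ('k \<times> 'l::finite) cmat"
  assumes "unital_star_hom \<phi>"
  shows "inj \<phi>"
proof -
  obtain u where u: "u \<in> unitary" "\<phi> = Ad u \<circ> (\<lambda>a. kron a (mat 1))"
    using unital_star_hom_eq_Ad_kron[OF assms] .
  then show ?thesis by (simp add: inj_compose inj_Ad inj_kron_one)
qed

section \<open>The frame space and its action of the projective unitary group\<close>

lemma continuous_on_vec_lambda_complex: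
  assumes "\<And>i. continuous_on S (\<lambda>z. f z i)"
  shows "continuous_on S (\<lambda>z. \<chi> i. f z i)"
  using assms unfolding continuous_on_def by (blast intro: tendsto_vec_lambda)

lemma continuous_on_matrix_mult [continuous_intros]:
  fixes f :: "'a::topological_space \<Rightarrow> complex ^ 'n::finite ^ 'm::finite" and g :: "'a \<Rightarrow> complex ^ 'p::finite ^ 'n"
  assumes "continuous_on S f" "continuous_on S g"
  shows "continuous_on S (\<lambda>z. f z ** g z)"
  unfolding matrix_matrix_mult_def
  by (intro continuous_on_vec_lambda_complex continuous_intros assms)

lemma continuous_on_matrix_vector_mult [continuous_intros]:
  fixes f :: "'a::topological_space \<Rightarrow> complex ^ 'n::finite ^ 'm::finite" and g :: "'a \<Rightarrow> complex ^ 'n"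
  assumes "continuous_on S f" "continuous_on S g"
  shows "continuous_on S (\<lambda>z. f z *v g z)"
  unfolding matrix_vector_mult_def
  by (intro continuous_on_vec_lambda_complex continuous_intros assms)

lemma continuous_on_star [continuous_intros]:
  assumes "continuous_on S f"
  shows "continuous_on S (\<lambda>z. star (f z))"
  unfolding star_def
  by (intro continuous_on_vec_lambda_complex continuous_intros assms)

lemma continuous_on_cscale [continuous_intros]:
  assumes "continuous_on S c" "continuous_on S f"
  shows "continuous_on S (\<lambda>z. cscale (c z) (f z))"
  unfolding cscale_def
  by (intro continuous_on_vec_lambda_complex continuous_intros assms)

lemma continuous_on_trace [continuous_intros]:
  fixes f :: "'a::topological_space \<Rightarrow> 'n::finite cmat"
  assumes "continuous_on S f"
  shows "continuous_on S (\<lambda>z. trace (f z))"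
  unfolding trace_def by (intro continuous_intros assms)

lemma continuous_on_cinner [continuous_intros]:
  assumes "continuous_on S f" "continuous_on S g"
  shows "continuous_on S (\<lambda>z. cinner (f z) (g z))"
  unfolding cinner_def by (intro continuous_intros assms)

lemma continuous_on_outer [continuous_intros]:
  assumes "continuous_on S f" "continuous_on S g"
  shows "continuous_on S (\<lambda>z. outer (f z) (g z))"
  unfolding outer_def by (intro continuous_on_vec_lambda_complex continuous_intros assms)

lemma continuous_on_Ad: "continuous_on S (\<lambda>u. Ad u a)"
  unfolding Ad_def by (intro continuous_intros)

text \<open>
  The norm of the type class is the Hilbert-Schmidt norm; in particular unitary matrices are bounded.
\<close>

lemma trace_star_mult_self: "trace (star a ** a) = of_real ((norm (a :: 'n::finite cmat))\<^sup>2)"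
proof -
  have "trace (star a ** a) = (\<Sum>j\<in>UNIV. \<Sum>i\<in>UNIV. cnj (a $ i $ j) * a $ i $ j)"
    by (simp add: trace_def matrix_matrix_mult_def star_def)
  also have "\<dots> = (\<Sum>i\<in>UNIV. \<Sum>j\<in>UNIV. cnj (a $ i $ j) * a $ i $ j)" by (rule sum.swap)
  also have "\<dots> = (\<Sum>i\<in>UNIV. of_real ((norm (a $ i))\<^sup>2))"
    by (simp only: cinner_self[symmetric] cinner_def)
  also have "\<dots> = of_real ((norm a)\<^sup>2)"
    by (simp add: norm_vec_def[of a] L2_set_def sum_nonneg del: of_real_power)
  finally show ?thesis .
qed

lemma unitary_star: "u \<in> unitary \<Longrightarrow> star u \<in> unitary"
  by (simp add: unitary_def)

lemma unitary_mult:
  assumes u: "u \<in> unitary" and v: "v \<in> unitary"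
  shows "u ** v \<in> unitary"
proof -
  have "star v ** star u ** (u ** v) = star v ** (star u ** u) ** v"
    "u ** v ** (star v ** star u) = u ** (v ** star v) ** star u"
    by (simp_all only: matrix_mul_assoc)
  then show ?thesis using u v by (simp add: unitary_def star_mult)
qed

lemma unitary_cscale:
  assumes "cmod c = 1" "u \<in> unitary"
  shows "cscale c u \<in> unitary"
proof -
  have "c * cnj c = 1" using assms(1) by (simp add: complex_norm_square[symmetric])
  then show ?thesis
    using assms(2) by (simp add: unitary_def star_cscale cscale_mult_left cscale_mult_right cscale_cscale mult.commute)
qed

lemma norm_unitary_vec:
  assumes "u \<in> unitary"
  shows "norm (u *v x) = norm x"
proof -
  have "cinner (u *v x) (u *v x) = cinner x x"
    using assms by (simp add: cinner_adjoint matrix_vector_mul_assoc unitary_def)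
  then have "(norm (u *v x))\<^sup>2 = (norm x)\<^sup>2" by (simp only: cinner_self of_real_eq_iff)
  then show ?thesis by (rule power2_eq_imp_eq) auto
qed

lemma compact_unitary: "compact (unitary :: 'n::finite cmat set)"
proof -
  have "closed (unitary :: 'n cmat set)"
    unfolding unitary_def Collect_conj_eq
    by (intro closed_Int closed_Collect_eq continuous_intros)
  moreover have "bounded (unitary :: 'n cmat set)"
    unfolding bounded_iff
  proof (intro exI ballI)
    fix u :: "'n cmat" assume "u \<in> unitary"
    then have "complex_of_real ((norm u)\<^sup>2) = of_real (real (CARD('n)))"
      unfolding trace_star_mult_self[symmetric] by (simp add: unitary_def trace_I)
    then have "(norm u)\<^sup>2 = real (CARD('n))" by (simp only: of_real_eq_iff)
    then show "norm u \<le> sqrt (real (CARD('n)))" by (simp add: real_le_rsqrt)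
  qed
  ultimately show ?thesis by (simp add: compact_eq_bounded_closed)
qed

lemma compact_space_unitary: "compact_space (top_of_set (unitary :: 'n::finite cmat set))"
  using compact_unitary by (intro compact_space_subtopology) simp

lemma compact_space_quotient_map_image:
  assumes q: "quotient_map X Y q" and X: "compact_space X"
  shows "compact_space Y"
  using image_compactin[OF _ quotient_imp_continuous_map[OF q]] X
  unfolding compact_space_def quotient_imp_surjective_map[OF q, symmetric] by blast

lemma quotient_map_Ad: "quotient_map (top_of_set unitary) PU Ad"
  unfolding PU_def by (rule quotient_map_final_topology) simp

lemma Ad_mult: "Ad u (Ad v a) = Ad (u ** v) a"
  by (simp add: Ad_def star_mult matrix_mul_assoc)

lemma Ad_comp: "Ad u \<circ> Ad v = Ad (u ** v)"
  by (simp add: fun_eq_iff Ad_mult)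

lemma Ad_one: "Ad (mat 1) = id"
  by (simp add: fun_eq_iff Ad_def)

lemma Ad_comp_star:
  assumes "u \<in> unitary"
  shows "Ad u \<circ> Ad (star u) = id" "Ad (star u) \<circ> Ad u = id"
  using assms by (simp_all add: Ad_comp unitary_def Ad_one)

lemma inv_Ad: "u \<in> unitary \<Longrightarrow> inv (Ad u) = Ad (star u)"
  by (rule inv_unique_comp) (simp_all add: Ad_comp_star)

lemma compact_group_PU:
  "compact_group (PU :: ('n::finite cmat \<Rightarrow> 'n cmat) topology) (\<circ>) id inv"
proof
  show "compact_space (PU :: ('n cmat \<Rightarrow> 'n cmat) topology)"
    using compact_space_quotient_map_image[OF quotient_map_Ad compact_space_unitary] .
  have "continuous_map (top_of_set unitary) (PU :: ('n cmat \<Rightarrow> 'n cmat) topology) (inv \<circ> Ad)"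
  proof (rule continuous_map_eq)
    have "continuous_map (top_of_set unitary) (top_of_set (unitary :: 'n cmat set)) star"
      using unitary_star by (auto simp: continuous_map_in_subtopology intro!: continuous_on_star[OF continuous_on_id])
    then show "continuous_map (top_of_set unitary) (PU :: ('n cmat \<Rightarrow> 'n cmat) topology) (Ad \<circ> star)"
      by (rule continuous_map_compose[OF _ quotient_imp_continuous_map[OF quotient_map_Ad]])
  qed (simp add: inv_Ad)
  then show "continuous_map PU (PU :: ('n cmat \<Rightarrow> 'n cmat) topology) inv"
    by (rule continuous_compose_quotient_map[OF quotient_map_Ad])
  fix g h k :: "'n cmat \<Rightarrow> 'n cmat"
  show "id \<in> topspace (PU :: ('n cmat \<Rightarrow> 'n cmat) topology)"
    unfolding topspace_PU by (rule rev_image_eqI[OF one_unitary]) (simp add: Ad_one)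
  show "g \<circ> h \<in> topspace PU" if "g \<in> topspace PU" "h \<in> topspace PU"
    using that unfolding topspace_PU by (auto simp: Ad_comp intro: unitary_mult)
  show "g \<circ> inv g = id" "inv g \<circ> g = id" if "g \<in> topspace PU"
    using that unfolding topspace_PU by (auto simp: inv_Ad Ad_comp_star)
qed (simp_all add: comp_assoc)

abbreviation hom_set :: "('m::finite cmat \<Rightarrow> 'n::finite cmat) set" where
  "hom_set \<equiv> {\<phi>. unital_star_hom \<phi>}"

lemma topspace_Fr: "topspace (Fr :: ('k::finite cmat \<Rightarrow> ('k \<times> 'l::finite) cmat) topology) = hom_set"
  by (simp add: Fr_def)

text \<open>
  Evaluation is jointly continuous although the function space carries the pointwise topology: by linearity
  finitely many coordinates determine the value.
\<close>

lemma continuous_on_apply_hom: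
  assumes f: "continuous_on S f" and b: "continuous_on S b" and hom: "\<And>z. z \<in> S \<Longrightarrow> unital_star_hom (f z)"
  shows "continuous_on S (\<lambda>z. f z (b z))"
proof -
  have "continuous_on S (\<lambda>z. \<Sum>i\<in>UNIV. \<Sum>j\<in>UNIV. cscale (b z $ i $ j) (f z (unit_matrix i j)))"
    by (intro continuous_intros b continuous_on_product_then_coordinatewise[OF f])
  then show ?thesis
    by (rule continuous_on_eq) (simp add: unital_star_hom_eq_sum_units[OF hom, symmetric])
qed

lemma continuous_map_into_Fr:
  "continuous_map Z Fr f \<longleftrightarrow>
     f \<in> topspace Z \<rightarrow> hom_set \<and> (\<forall>a. continuous_map Z euclidean (\<lambda>z. f z a))"
  by (auto simp: Fr_def continuous_map_in_subtopology euclidean_product_topology[symmetric]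
      continuous_map_componentwise_UNIV)

lemma Fr_action: "continuous_right_action PU (\<circ>) id (Fr :: ('k::finite cmat \<Rightarrow> ('k \<times> 'l::finite) cmat) topology) (\<circ>)"
  unfolding continuous_right_action_def
proof (intro conjI ballI)
  let ?Z = "prod_topology (Fr :: ('k cmat \<Rightarrow> ('k \<times> 'l) cmat) topology) PU"
  have "continuous_map ?Z euclidean (\<lambda>z. fst z (snd z a))" for a
  proof -
    have "continuous_map PU euclidean (\<lambda>g :: 'k cmat \<Rightarrow> 'k cmat. g a)"
      by (rule continuous_compose_quotient_map[OF quotient_map_Ad]) (simp add: o_def continuous_on_Ad)
    then have "continuous_map ?Z (prod_topology Fr euclidean) (\<lambda>z. (fst z, snd z a))"
      by (intro continuous_map_pairedI continuous_map_fst continuous_map_compose[OF continuous_map_snd, unfolded o_def])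
    moreover have "continuous_map (prod_topology (Fr :: ('k cmat \<Rightarrow> ('k \<times> 'l) cmat) topology) euclidean) euclidean (\<lambda>w. fst w (snd w))"
    proof -
      have "continuous_on ((hom_set :: ('k cmat \<Rightarrow> ('k \<times> 'l) cmat) set) \<times> UNIV) (\<lambda>w. fst w (snd w))"
        by (rule continuous_on_apply_hom) (auto intro: continuous_intros)
      moreover have "prod_topology (Fr :: ('k cmat \<Rightarrow> ('k \<times> 'l) cmat) topology) (euclidean :: 'k cmat topology)
          = top_of_set (hom_set \<times> UNIV)"
        unfolding Fr_def using prod_topology_subtopology_eu[of hom_set UNIV] by simp
      ultimately show ?thesis by simp
    qed
    ultimately show ?thesis using continuous_map_compose by (fastforce simp: o_def)
  qed
  then show "continuous_map ?Z Fr (\<lambda>(\<phi>, g). \<phi> \<circ> g)"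
    by (auto simp: continuous_map_into_Fr topspace_Fr topspace_PU case_prod_unfold
        intro!: unital_star_hom_comp unital_star_hom_Ad)
qed (simp_all add: comp_assoc)

lemma Hausdorff_space_Fr: "Hausdorff_space Fr"
  unfolding Fr_def euclidean_product_topology[symmetric]
  by (intro Hausdorff_space_subtopology) (simp add: Hausdorff_space_product_topology)

text \<open>
  Surjectivity is the Skolem-Noether theorem, and a continuous map from a compact space to a Hausdorff space is
  closed.
\<close>

lemma quotient_map_unitary_Fr:
  "quotient_map (top_of_set unitary) (Fr :: ('k::finite cmat \<Rightarrow> ('k \<times> 'l::finite) cmat) topology)
     (\<lambda>u. Ad u \<circ> (\<lambda>a. kron a (mat 1)))"
proof (rule continuous_closed_imp_quotient_map)
  let ?f = "\<lambda>u :: ('k \<times> 'l) cmat. Ad u \<circ> (\<lambda>a :: 'k cmat. kron a (mat 1))"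
  have hom: "unital_star_hom (?f u)" if "u \<in> unitary" for u
    by (intro unital_star_hom_comp unital_star_hom_Ad unital_star_hom_kron_one that)
  show c: "continuous_map (top_of_set unitary) Fr ?f"
    using hom by (auto simp: continuous_map_into_Fr continuous_on_Ad)
  show "closed_map (top_of_set unitary) Fr ?f"
    by (rule T1_Spaces.continuous_imp_closed_map[OF c compact_space_unitary Hausdorff_space_Fr])
  show "?f ` topspace (top_of_set unitary) = topspace Fr"
  proof
    show "?f ` topspace (top_of_set unitary) \<subseteq> topspace Fr"
      using hom by (auto simp: topspace_Fr)
    show "topspace Fr \<subseteq> ?f ` topspace (top_of_set unitary)"
    proof
      fix \<phi> :: "'k cmat \<Rightarrow> ('k \<times> 'l) cmat" assume "\<phi> \<in> topspace Fr"
      then obtain u where "u \<in> unitary" "\<phi> = ?f u"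
        using unital_star_hom_eq_Ad_kron by (auto simp: topspace_Fr)
      then show "\<phi> \<in> ?f ` topspace (top_of_set unitary)" by auto
    qed
  qed
qed

lemma compact_space_Fr: "compact_space (Fr :: ('k::finite cmat \<Rightarrow> ('k \<times> 'l::finite) cmat) topology)"
  by (rule compact_space_quotient_map_image[OF quotient_map_unitary_Fr compact_space_unitary])

lemma completely_regular_space_Fr:
  "completely_regular_space (Fr :: ('k::finite cmat \<Rightarrow> ('k \<times> 'l::finite) cmat) topology)"
  by (intro locally_compact_regular_imp_completely_regular_space compact_imp_locally_compact_space
      compact_space_Fr disjI1 Hausdorff_space_Fr)

section \<open>The matrix Grassmannian as a quotient of the frame space\<close>

text \<open>
  The topology of \<open>Gr\<close> comes from \<open>U(kl)\<close> through \<open>PU(kl)\<close> and its coset space.  The composite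
  map sends \<open>u\<close> to the image of \<open>a \<mapsto> u (a \<otimes> 1) u\<^sup>*\<close>, and so factors through \<open>Fr\<close>; the second factor
  of a quotient map whose first factor is a quotient map is one as well.
\<close>

lemma quotient_map_Fr_Gr:
  "quotient_map (Fr :: ('k::finite cmat \<Rightarrow> ('k \<times> 'l::finite) cmat) topology) Gr range"
proof -
  let ?f = "\<lambda>u :: ('k \<times> 'l) cmat. Ad u \<circ> (\<lambda>a :: 'k cmat. kron a (mat 1))"
  have "quotient_map PU (homogeneous_space :: (('k \<times> 'l) cmat \<Rightarrow> ('k \<times> 'l) cmat) set topology) (orbit (\<circ>) PU_kron)"
    unfolding homogeneous_space_def orbit_space_def by (rule quotient_map_final_topology) (rule refl)
  from quotient_map_compose[OF quotient_map_Ad this]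
  have q1: "quotient_map (top_of_set unitary) (homogeneous_space :: (('k \<times> 'l) cmat \<Rightarrow> ('k \<times> 'l) cmat) set topology)
      (orbit (\<circ>) PU_kron \<circ> Ad)" .
  have cr: "coset_subalgebra (orbit (\<circ>) PU_kron (Ad u)) = range (?f u)" for u
    by (simp add: coset_subalgebra_orbit image_comp)
  have surj: "range ` (topspace Fr) = (matrix_subalgebras :: ('k \<times> 'l) cmat set set)"
  proof (intro subset_antisym subsetI)
    fix S :: "('k \<times> 'l) cmat set" assume "S \<in> matrix_subalgebras"
    then show "S \<in> range ` topspace Fr"
      by (auto simp: matrix_subalgebras_def topspace_Fr bij_betw_def)
  next
    fix S :: "('k \<times> 'l) cmat set" assume "S \<in> range ` topspace Fr"
    then obtain \<phi> :: "'k cmat \<Rightarrow> ('k \<times> 'l) cmat" where "unital_star_hom \<phi>" "S = range \<phi>"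
      by (auto simp: topspace_Fr)
    then show "S \<in> matrix_subalgebras"
      unfolding matrix_subalgebras_def
      by (auto simp: unital_star_subalgebra_range bij_betw_def intro!: exI[of _ \<phi>] inj_unital_star_hom)
  qed
  have "quotient_map homogeneous_space Gr (coset_subalgebra :: _ \<Rightarrow> ('k \<times> 'l) cmat set)"
    unfolding Gr_def
  proof (rule quotient_map_final_topology)
    have "coset_subalgebra ` topspace homogeneous_space = (coset_subalgebra \<circ> (orbit (\<circ>) PU_kron \<circ> Ad)) ` (unitary :: ('k \<times> 'l) cmat set)"
      unfolding image_comp[symmetric, of coset_subalgebra] using quotient_imp_surjective_map[OF q1] by simp
    also have "\<dots> = range ` (?f ` unitary)"
      unfolding image_image o_apply by (rule image_cong[OF refl]) (rule cr[unfolded o_apply])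
    also have "?f ` unitary = topspace Fr"
      using quotient_imp_surjective_map[OF quotient_map_unitary_Fr[where 'k = 'k and 'l = 'l]] by simp
    finally show "coset_subalgebra ` topspace homogeneous_space = (matrix_subalgebras :: ('k \<times> 'l) cmat set set)"
      by (simp only: surj)
  qed
  from quotient_map_compose[OF q1 this]
  have "quotient_map (top_of_set unitary) Gr (coset_subalgebra \<circ> (orbit (\<circ>) PU_kron \<circ> Ad :: _ \<Rightarrow> (('k \<times> 'l) cmat \<Rightarrow> _) set))" .
  moreover have "coset_subalgebra \<circ> (orbit (\<circ>) PU_kron \<circ> Ad) = range \<circ> ?f"
    by (rule ext) (simp only: o_apply cr)
  ultimately have q: "quotient_map (top_of_set unitary) Gr (range \<circ> ?f)" by simp
  have f: "quotient_map (top_of_set unitary) Fr ?f" by (rule quotient_map_unitary_Fr)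
  show ?thesis
    using q unfolding quotient_map_compose_eq[OF f] .
qed

text \<open>
  If the images agree, \<open>\<phi>\<^sup>-\<^sup>1 \<psi>\<close> is a star automorphism of \<open>M\<^sub>k(\<complex>)\<close>, hence inner.
\<close>

lemma range_eq_iff_same_PU_orbit:
  fixes \<phi> \<psi> :: "'k::finite cmat \<Rightarrow> ('k \<times> 'l::finite) cmat"
  assumes \<phi>: "unital_star_hom \<phi>" and \<psi>: "unital_star_hom \<psi>"
  shows "range \<phi> = range \<psi> \<longleftrightarrow> (\<exists>g \<in> topspace PU. \<psi> = \<phi> \<circ> g)"
proof
  assume eq: "range \<phi> = range \<psi>"
  have inj: "\<phi> a = \<phi> b \<longleftrightarrow> a = b" for a b using inj_unital_star_hom[OF \<phi>] by (auto dest: injD)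
  define \<alpha> where "\<alpha> = inv \<phi> \<circ> \<psi>"
  have \<phi>\<alpha>: "\<phi> (\<alpha> a) = \<psi> a" for a
    using eq by (simp add: \<alpha>_def f_inv_into_f)
  have "unital_star_hom \<alpha>"
    unfolding unital_star_hom_def
    by (intro conjI allI; rule inj[THEN iffD1])
       (simp_all add: \<phi>\<alpha> unital_star_hom_add[OF \<phi>] unital_star_hom_cscale[OF \<phi>]
         unital_star_hom_mult[OF \<phi>] unital_star_hom_star[OF \<phi>] unital_star_hom_one[OF \<phi>]
         unital_star_hom_add[OF \<psi>] unital_star_hom_cscale[OF \<psi>]
         unital_star_hom_mult[OF \<psi>] unital_star_hom_star[OF \<psi>] unital_star_hom_one[OF \<psi>])
  then obtain g where "g \<in> unitary" "\<alpha> = Ad g" by (rule unital_star_endomorphism_eq_Ad)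
  then show "\<exists>g \<in> topspace PU. \<psi> = \<phi> \<circ> g"
    using \<phi>\<alpha> by (intro bexI[of _ \<alpha>]) (auto simp: topspace_PU)
next
  assume "\<exists>g \<in> topspace PU. \<psi> = \<phi> \<circ> g"
  then obtain u where u: "u \<in> unitary" "\<psi> = \<phi> \<circ> Ad u" by (auto simp: topspace_PU)
  have "Ad u (Ad (star u) a) = a" for a
    using Ad_comp_star(1)[OF u(1)] by (simp add: fun_eq_iff)
  then have "range (Ad u) = UNIV" by (rule surjI)
  then show "range \<phi> = range \<psi>" unfolding u(2) image_comp[symmetric] by simp
qed

section \<open>Polar parts by maximization\<close>

text \<open>
  The unitary factors of the polar decompositions of \<open>v\<close>, characterized as the unitary matrices nearest
  to \<open>v\<close> in the Hilbert-Schmidt norm.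
\<close>

definition polar_maximizer :: "'n::finite cmat \<Rightarrow> 'n cmat \<Rightarrow> bool" where
  "polar_maximizer v u \<longleftrightarrow> u \<in> unitary \<and>
     (\<forall>u' \<in> unitary. Re (trace (star u' ** v)) \<le> Re (trace (star u ** v)))"

text \<open>
  Write \<open>h = u\<^sup>* v\<close>.  The matrix \<open>u\<close> is compared with \<open>u w\<close>, where the unitary \<open>w\<close> multiplies \<open>x\<close> by
  a phase \<open>c\<close> and fixes its orthogonal complement.  With \<open>z = \<langle>x, h x\<rangle>\<close>, maximality says
  \<open>Re ((1 - c\<^sup>*) z) \<ge> 0\<close>; if \<open>c\<close> is the phase of \<open>z\<close> this is \<open>Re z \<ge> \<bar>z\<bar>\<close>.
\<close>

lemma polar_maximizer_positive:
  assumes u: "polar_maximizer v u" and x: "norm x = 1"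
  shows "cinner x ((star u ** v) *v x) = of_real (cmod (cinner x ((star u ** v) *v x)))"
proof -
  define h where "h = star u ** v"
  define z where "z = cinner x (h *v x)"
  have xx: "cinner x x = 1" using x by (simp add: cinner_self)
  have "z = of_real (cmod z)" if "z \<noteq> 0"
  proof -
    define c where "c = sgn z"
    have c: "cmod c = 1" "cnj c * z = of_real (cmod z)"
    proof -
      show "cmod c = 1" using that by (simp add: c_def norm_sgn)
      have "cnj c * z = (z * cnj z) / of_real (cmod z)"
        by (simp add: c_def sgn_div_norm scaleR_conv_of_real field_simps)
      then show "cnj c * z = of_real (cmod z)"
        using that by (simp add: complex_norm_square[symmetric] power2_eq_square)
    qed
    then have cc: "c * cnj c = 1" by (simp add: complex_norm_square[symmetric])
    define P where "P = outer x x"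
    have P: "P ** P = P" "star P = P" by (simp_all add: P_def outer_outer xx star_outer)
    define w where "w = mat 1 - cscale (1 - c) P"
    have sw: "star w = mat 1 - cscale (1 - cnj c) P"
    proof -
      have "star (a - b) = star a - star b" for a b :: "'a cmat" by (simp add: star_def vec_eq_iff)
      then show ?thesis by (simp add: w_def star_cscale P)
    qed
    have "(1 - c) * (1 - cnj c) = (1 - c) + (1 - cnj c)"
      by (simp add: algebra_simps cc)
    then have "cscale ((1 - c) * (1 - cnj c)) P = cscale (1 - c) P + cscale (1 - cnj c) P"
      by (simp only: cscale_def vec_eq_iff vec_lambda_beta vector_add_component distrib_right) simp
    then have "star w ** w = mat 1" "w ** star w = mat 1"
      unfolding sw unfolding w_def
      by (simp_all add: matrix_diff_ldistrib matrix_diff_rdistrib cscale_diff cscale_mult_left cscale_mult_right cscale_cscale P mult.commute)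
    then have "w \<in> unitary" by (simp add: unitary_def)
    then have "u ** w \<in> unitary" using u by (simp add: polar_maximizer_def unitary_mult)
    then have "Re (trace (star (u ** w) ** v)) \<le> Re (trace h)"
      using u by (simp add: polar_maximizer_def h_def)
    moreover have "star (u ** w) ** v = h - cscale (1 - cnj c) (outer x x ** h)"
      by (simp add: star_mult matrix_mul_assoc[symmetric] h_def[symmetric] sw matrix_diff_rdistrib cscale_mult_left P_def)
    moreover have "trace (outer x x ** h) = z"
      using trace_mul_sym[of "outer x x" h] by (simp add: mult_outer trace_outer z_def)
    ultimately have "0 \<le> Re ((1 - cnj c) * z)" by (simp add: trace_sub trace_cscale)
    moreover have "(1 - cnj c) * z = z - of_real (cmod z)" by (simp add: left_diff_distrib c)
    ultimately have "cmod z \<le> Re z" by simp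
    then have "Re z = cmod z" using complex_Re_le_cmod[of z] by simp
    then have "Im z = 0" using cmod_power2[of z] by simp
    with \<open>Re z = cmod z\<close> show ?thesis by (simp add: complex_eq_iff)
  qed
  then show ?thesis by (cases "z = 0") (simp_all add: z_def h_def)
qed

text \<open>
  By polarization with the coefficients \<open>1\<close> and \<open>\<i>\<close>.
\<close>

lemma star_eq_self_if_real_form:
  fixes h :: "'n::finite cmat"
  assumes real: "\<And>x. Im (cinner x (h *v x)) = 0"
  shows "star h = h"
proof -
  define B where "B x y = cinner x (h *v y) - cinner x (star h *v y)" for x y
  have zero: "B x x = 0" for x
  proof -
    have "cinner x (star h *v x) = cnj (cinner x (h *v x))"
      by (metis cinner_adjoint cinner_commute)
    then show ?thesis using real[of x] by (simp add: B_def complex_eq_iff)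
  qed
  have add: "cinner (x + y) z = cinner x z + cinner y z" for x y z :: "complex ^ 'n"
    by (simp add: cinner_def algebra_simps sum.distrib)
  have B: "B x y = 0" for x y
  proof -
    have "B (x + y) (x + y) = B x x + B y y + (B x y + B y x)"
      by (simp add: B_def add cinner_add_right matrix_vector_right_distrib)
    then have 1: "B x y + B y x = 0" by (simp add: zero)
    have "B (x + \<i> *s y) (x + \<i> *s y) = B x x + B y y + \<i> * (B x y - B y x)"
      by (simp add: B_def add cinner_add_right matrix_vector_right_distrib vector_scalar_commute
          cinner_scale_left cinner_scale_right algebra_simps)
    then have "B x y - B y x = 0" by (simp add: zero)
    with 1 show ?thesis by (simp add: complex_eq_iff)
  qed
  have "h $ i $ j = star h $ i $ j" for i j
    using B[of "axis i 1" "axis j 1"] by (simp add: B_def matrix_nth_eq_cinner)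
  then show ?thesis by (simp add: vec_eq_iff)
qed

lemma trace_star_mult_mult:
  fixes h x :: "'n::finite cmat"
  shows "trace (star x ** h ** x) = (\<Sum>i\<in>UNIV. cinner (x *v axis i 1) (h *v (x *v axis i 1)))"
proof -
  have "trace (star x ** h ** x) = (\<Sum>i\<in>UNIV. cinner (axis i 1) ((star x ** h ** x) *v axis i 1))"
    unfolding trace_def by (rule sum.cong[OF refl matrix_nth_eq_cinner])
  then show ?thesis
    by (simp only: cinner_adjoint matrix_vector_mul_assoc[symmetric])
qed

text \<open>
  With \<open>h = u\<^sup>* v\<close> positive definite and \<open>u' = u w\<close>, the trace of \<open>(1 - w)\<^sup>* h (1 - w)\<close> has real part
  \<open>2 Re tr h - 2 Re tr (w\<^sup>* h)\<close>.  This vanishes since \<open>u\<close> and \<open>u'\<close> have the same maximal value, and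
  definiteness then forces \<open>w = 1\<close>.
\<close>

lemma polar_maximizer_unique:
  assumes u: "polar_maximizer v u" and u': "polar_maximizer v u'"
    and nz: "\<And>x. norm x = 1 \<Longrightarrow> cinner x ((star u ** v) *v x) \<noteq> 0"
  shows "u' = u"
proof -
  define h where "h = star u ** v"
  define w where "w = star u ** u'"
  define x where "x = mat 1 - w"
  have uU: "star u ** u = mat 1" "u ** star u = mat 1" "star u' ** u' = mat 1" "u' ** star u' = mat 1"
    using u u' by (auto simp: polar_maximizer_def unitary_def)
  have pos: "Im (cinner y (h *v y)) = 0" "Re (cinner y (h *v y)) \<ge> 0"
    "y \<noteq> 0 \<Longrightarrow> Re (cinner y (h *v y)) \<noteq> 0" for y
  proof -
    have *: "Im (cinner y (h *v y)) = 0 \<and> Re (cinner y (h *v y)) > 0" if y: "y \<noteq> 0"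
    proof -
      define e where "e = complex_of_real (1 / norm y) *s y"
      have ne: "norm e = 1" using y by (simp add: e_def norm_cscale_vec norm_divide)
      let ?r = "cmod (cinner e (h *v e))"
      have r: "cinner e (h *v e) = of_real ?r" "?r > 0"
        using polar_maximizer_positive[OF u ne] nz[OF ne] by (simp_all add: h_def)
      have "y = complex_of_real (norm y) *s e"
        using y by (simp add: e_def vec_eq_iff)
      then have "cinner y (h *v y) = of_real (norm y) * (of_real (norm y) * cinner e (h *v e))"
        by (metis (no_types) cinner_scale_left cinner_scale_right vector_scalar_commute complex_cnj_complex_of_real)
      then have "cinner y (h *v y) = of_real (norm y * (norm y * ?r))" using r(1) by simp
      then show ?thesis using y r(2) by simp
    qed
    show "Im (cinner y (h *v y)) = 0" "Re (cinner y (h *v y)) \<ge> 0"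
      "y \<noteq> 0 \<Longrightarrow> Re (cinner y (h *v y)) \<noteq> 0"
      using * by (cases "y = 0"; simp add: cinner_def)+
  qed
  have sh: "star h = h" by (rule star_eq_self_if_real_form) (rule pos(1))
  have wh: "star w ** h = star u' ** v"
  proof -
    have "star w ** h = star u' ** (u ** star u) ** v"
      by (simp only: w_def h_def star_mult star_star matrix_mul_assoc)
    then show ?thesis by (simp add: uU)
  qed
  have ww: "w ** star w = mat 1"
  proof -
    have "w ** star w = star u ** (u' ** star u') ** u"
      by (simp only: w_def star_mult star_star matrix_mul_assoc)
    then show ?thesis by (simp add: uU)
  qed
  have "Re (trace (star u' ** v)) = Re (trace (star u ** v))"
    using u u' by (intro antisym) (auto simp: polar_maximizer_def)
  then have 1: "Re (trace (star w ** h)) = Re (trace h)" unfolding wh by (simp add: h_def)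
  have 2: "Re (trace (h ** w)) = Re (trace h)"
    using trace_star[of "h ** w"] 1 by (simp add: star_mult sh)
  have "trace (star w ** h ** w) = trace (w ** (star w ** h))" by (rule trace_mul_sym)
  then have 3: "trace (star w ** h ** w) = trace h" by (simp add: matrix_mul_assoc ww)
  have "star x ** h ** x = h - h ** w - star w ** h + star w ** h ** w"
  proof -
    have "star x = mat 1 - star w" by (simp add: x_def star_def mat_def vec_eq_iff)
    then show ?thesis by (simp add: x_def matrix_diff_ldistrib matrix_diff_rdistrib)
  qed
  then have "Re (trace (star x ** h ** x)) = 0" by (simp add: trace_sub trace_add 1 2 3)
  then have "(\<Sum>i\<in>UNIV. Re (cinner (x *v axis i 1) (h *v (x *v axis i 1)))) = 0"
    by (simp add: trace_star_mult_mult)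
  then have "x *v axis i 1 = 0" for i
    using pos(2,3) by (subst (asm) sum_nonneg_eq_0_iff) auto
  then have "x $ j $ i = 0" for i j
    by (metis matrix_vector_axis_nth zero_index)
  then have "w = mat 1" by (simp add: x_def vec_eq_iff)
  then have "u ** (star u ** u') = u" by (simp add: w_def)
  then show ?thesis by (simp add: matrix_mul_assoc uU)
qed

text \<open>
  The form \<open>D z = Q x \<bar>z\<bar>\<^sup>2 - Q z\<close> is nonnegative, so the parallelogram law makes its zero set closed under
  subtraction.  The component of \<open>y\<close> orthogonal to \<open>x\<close> lies in it, and would be a second
  maximizer if it were nonzero.
\<close>

lemma quadratic_maximizer_unique:
  fixes Q :: "complex ^ 'n::finite \<Rightarrow> real"
  assumes scale: "\<And>c x. Q (c *s x) = (cmod c)\<^sup>2 * Q x"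
    and par: "\<And>x y. Q (x + y) + Q (x - y) = 2 * Q x + 2 * Q y"
    and x: "norm x = 1" "\<And>z. norm z = 1 \<Longrightarrow> Q z \<le> Q x"
    and y: "norm y = 1" "\<And>z. norm z = 1 \<Longrightarrow> Q z \<le> Q y"
    and simple: "\<And>z. \<lbrakk>norm z = 1; cinner x z = 0\<rbrakk> \<Longrightarrow> Q z \<noteq> Q x"
  shows "y = cinner x y *s x"
proof (rule ccontr)
  define D where "D z = Q x * (norm z)\<^sup>2 - Q z" for z
  have unit: "norm (complex_of_real (1 / norm z) *s z) = 1" if "z \<noteq> 0" for z :: "complex ^ 'n"
    using that by (simp add: norm_cscale_vec norm_divide)
  have Qz: "Q z = (norm z)\<^sup>2 * Q (complex_of_real (1 / norm z) *s z)" if "z \<noteq> 0" for z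
    using that by (simp add: scale norm_divide power_divide)
  have Q0: "Q 0 = 0" using scale[of 0 0] by simp
  have D: "D z \<ge> 0" for z
  proof (cases "z = 0")
    case False
    have "(norm z)\<^sup>2 * Q (complex_of_real (1 / norm z) *s z) \<le> (norm z)\<^sup>2 * Q x"
      by (intro mult_left_mono x(2) unit False) simp
    then show ?thesis using Qz[OF False] by (simp add: D_def mult.commute)
  qed (simp add: D_def Q0)
  have Dpar: "D (a + b) + D (a - b) = 2 * D a + 2 * D b" for a b
  proof -
    have "(norm (a + b))\<^sup>2 + (norm (a - b))\<^sup>2 = 2 * (norm a)\<^sup>2 + 2 * (norm b)\<^sup>2"
      by (simp add: power2_norm_eq_inner algebra_simps inner_commute)
    then have "Q x * (norm (a + b))\<^sup>2 + Q x * (norm (a - b))\<^sup>2 = Q x * (2 * (norm a)\<^sup>2 + 2 * (norm b)\<^sup>2)"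
      by (simp only: distrib_left[symmetric])
    then show ?thesis using par[of a b] by (simp add: D_def algebra_simps)
  qed
  assume ne: "y \<noteq> cinner x y *s x"
  define z where "z = y - cinner x y *s x"
  have z: "z \<noteq> 0" using ne by (simp add: z_def)
  have "Q x = Q y" using x y by (intro antisym) auto
  then have "D y = 0" by (simp add: D_def y)
  moreover have "D (cinner x y *s x) = 0" by (simp add: D_def scale norm_cscale_vec x power_mult_distrib)
  ultimately have "D z = 0" using Dpar[of y "cinner x y *s x"] D[of "y + cinner x y *s x"] D[of z]
    by (simp add: z_def)
  then have "Q x * (norm z)\<^sup>2 = (norm z)\<^sup>2 * Q (complex_of_real (1 / norm z) *s z)"
    using Qz[OF z] by (simp add: D_def)
  then have "Q (complex_of_real (1 / norm z) *s z) = Q x" using z by simp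
  moreover have "cinner x (complex_of_real (1 / norm z) *s z) = 0"
    by (simp add: z_def cinner_scale_right cinner_diff_right cinner_self x)
  ultimately show False using simple[OF unit[OF z]] by blast
qed

text \<open>
  The squared distance of a unitary \<open>y\<close> from the identity is \<open>2 n - 2 Re tr y\<close>.
\<close>

lemma unitary_eq_one_if_trace:
  fixes y :: "'n::finite cmat"
  assumes y: "y \<in> unitary" and tr: "real (CARD('n)) \<le> Re (trace y)"
  shows "y = mat 1"
proof -
  define x where "x = y - mat 1"
  have "star x ** x = mat 1 - y - star y + mat 1"
  proof -
    have "star x = star y - mat 1" by (auto simp: x_def star_def mat_def vec_eq_iff)
    then show ?thesis using y by (simp add: x_def unitary_def matrix_diff_ldistrib matrix_diff_rdistrib)
  qed
  then have "trace (star x ** x) = trace (mat 1 :: 'n cmat) - trace y - cnj (trace y) + trace (mat 1 :: 'n cmat)"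
    by (simp only: trace_sub trace_add trace_star)
  then have "Re (trace (star x ** x)) = 2 * real (CARD('n)) - 2 * Re (trace y)"
    by (simp add: trace_I)
  then have "(norm x)\<^sup>2 \<le> 0" using tr by (simp add: trace_star_mult_self)
  then show ?thesis by (simp add: x_def)
qed

section \<open>Equivariant local maps from frames to the projective unitary group\<close>

lemma outer_eq_sum: "outer x y = (\<Sum>j\<in>UNIV. cscale (cnj (y $ j)) (outer x (axis j 1)))"
proof -
  have "outer x y $ p $ q = (\<Sum>j\<in>UNIV. cscale (cnj (y $ j)) (outer x (axis j 1))) $ p $ q" for p q
  proof -
    have "(\<Sum>j\<in>UNIV. cscale (cnj (y $ j)) (outer x (axis j 1))) $ p $ q
        = (\<Sum>j\<in>UNIV. if j = q then cnj (y $ j) * x $ p else 0)"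
      unfolding sum_component
      by (intro sum.cong refl) (simp add: cscale_def outer_def axis_def)
    then show ?thesis by (simp add: outer_def mult.commute)
  qed
  then show ?thesis by (simp add: vec_eq_iff)
qed

lemma Ad_outer: "Ad w (outer x y) = outer (w *v x) (w *v y)"
  by (simp add: Ad_def mult_outer outer_mult)

lemma closedin_family_le:
  fixes f g :: "'i \<Rightarrow> 'z::topological_space \<Rightarrow> real"
  assumes "\<And>i. i \<in> I \<Longrightarrow> continuous_on T (f i)" "\<And>i. i \<in> I \<Longrightarrow> continuous_on T (g i)"
  shows "closedin (top_of_set T) {s \<in> T. \<forall>i \<in> I. f i s \<le> g i s}"
proof (cases "I = {}")
  case False
  have "closedin (top_of_set T) {s \<in> T. f i s \<le> g i s}" if "i \<in> I" for i
  proof -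
    have "continuous_on T (\<lambda>s. g i s - f i s)" by (intro continuous_intros assms that)
    from continuous_closedin_preimage[OF this closed_atLeast[of 0]] show ?thesis
      by (simp add: vimage_def Collect_conj_eq[symmetric] Int_def)
  qed
  then have "closedin (top_of_set T) (\<Inter>i\<in>I. {s \<in> T. f i s \<le> g i s})" using False by blast
  moreover have "(\<Inter>i\<in>I. {s \<in> T. f i s \<le> g i s}) = {s \<in> T. \<forall>i \<in> I. f i s \<le> g i s}" using False by auto
  ultimately show ?thesis by simp
qed simp

lemma closedin_eq:
  fixes f g :: "'z::topological_space \<Rightarrow> complex"
  assumes "continuous_on T f" "continuous_on T g"
  shows "closedin (top_of_set T) {s \<in> T. f s = g s}"
proof -
  have "continuous_on T (\<lambda>s. f s - g s)" by (intro continuous_intros assms)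
  from continuous_closedin_preimage[OF this closed_singleton[of 0]] show ?thesis
    by (simp add: vimage_def Int_def)
qed

text \<open>
  The frame \<open>\<phi>0\<close> is the centre of the local construction, and the index \<open>i0\<close> singles out the diagonal
  matrix unit to which lines are compared.
\<close>

locale reference_frame =
  fixes \<phi>0 :: "'k::finite cmat \<Rightarrow> ('k \<times> 'l::finite) cmat" and i0 :: 'k
  assumes \<phi>0: "unital_star_hom \<phi>0"
begin

text \<open>
  For unit vectors \<open>x\<close>, the Hilbert-Schmidt inner product of the projections \<open>\<phi>(x x\<^sup>*)\<close>
  and \<open>\<phi>0 (unit_matrix i0 i0)\<close>.
\<close>

definition overlap :: "('k cmat \<Rightarrow> ('k \<times> 'l) cmat) \<Rightarrow> complex ^ 'k \<Rightarrow> real" where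
  "overlap \<phi> x = Re (trace (\<phi> (outer x x) ** \<phi>0 (unit_matrix i0 i0)))"

text \<open>
  If \<open>\<phi> = \<phi>0 \<circ> Ad w\<close> and \<open>w x\<close> is a multiple of the axis \<open>i0\<close>, this matrix is a multiple of
  \<open>w\<^sup>*\<close>, so that its unitary polar part determines \<open>Ad w\<close>.
\<close>

definition transition :: "('k cmat \<Rightarrow> ('k \<times> 'l) cmat) \<Rightarrow> complex ^ 'k \<Rightarrow> 'k cmat" where
  "transition \<phi> x = (\<chi> j i. trace (\<phi> (outer x (axis j 1)) ** \<phi>0 (unit_matrix i i0)))"

definition maximizers :: "('k cmat \<Rightarrow> ('k \<times> 'l) cmat) \<Rightarrow> ((complex ^ 'k) \<times> 'k cmat) set" where
  "maximizers \<phi> = {(x, u). x \<in> sphere 0 1 \<and> u \<in> unitary \<and>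
     (\<forall>x' \<in> sphere 0 1. overlap \<phi> x' \<le> overlap \<phi> x) \<and>
     (\<forall>u' \<in> unitary. Re (trace (star u' ** transition \<phi> x)) \<le> Re (trace (star u ** transition \<phi> x)))}"

text \<open>
  The two ways in which uniqueness can fail, each witnessed by a unit vector \<open>z\<close>: a second line of maximal
  overlap orthogonal to the first, or a null vector of the positive part of the transition matrix.  Both are
  closed conditions, so the frames without a witness form an open set.
\<close>

definition degenerate :: "('k cmat \<Rightarrow> ('k \<times> 'l) cmat) \<Rightarrow> ((complex ^ 'k) \<times> 'k cmat) \<Rightarrow> complex ^ 'k \<Rightarrow> bool" where
  "degenerate \<phi> = (\<lambda>(x, u) z. cinner x z = 0 \<and> overlap \<phi> z = overlap \<phi> x \<or>
     cinner z ((star u ** transition \<phi> x) *v z) = 0)"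

definition slice_domain :: "('k cmat \<Rightarrow> ('k \<times> 'l) cmat) set" where
  "slice_domain = {\<phi> \<in> hom_set. \<forall>m \<in> maximizers \<phi>. \<forall>z \<in> sphere 0 1. \<not> degenerate \<phi> m z}"

text \<open>
  Any maximizer may be chosen: over \<open>slice_domain\<close> two of them differ by a common phase, which \<open>Ad\<close>
  does not see.
\<close>

definition slice_map :: "('k cmat \<Rightarrow> ('k \<times> 'l) cmat) \<Rightarrow> 'k cmat \<Rightarrow> 'k cmat" where
  "slice_map \<phi> = Ad (star (snd (SOME m. m \<in> maximizers \<phi>)))"

lemma maximizers_polar: "(x, u) \<in> maximizers \<phi> \<Longrightarrow> polar_maximizer (transition \<phi> x) u"
  by (simp add: maximizers_def polar_maximizer_def)

section \<open>Dependence of the maximizers on the frame\<close>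

lemma continuous_on_overlap:
  assumes f: "continuous_on S f" and x: "continuous_on S x" and hom: "\<And>s. s \<in> S \<Longrightarrow> unital_star_hom (f s)"
  shows "continuous_on S (\<lambda>s. overlap (f s) (x s))"
  unfolding overlap_def
  by (intro continuous_on_Re continuous_on_trace continuous_on_matrix_mult continuous_on_const
      continuous_on_apply_hom[OF f continuous_on_outer[OF x x] hom])

lemma continuous_on_transition:
  assumes f: "continuous_on S f" and x: "continuous_on S x" and hom: "\<And>s. s \<in> S \<Longrightarrow> unital_star_hom (f s)"
  shows "continuous_on S (\<lambda>s. transition (f s) (x s))"
  unfolding transition_def
  by (intro continuous_on_vec_lambda_complex continuous_on_trace continuous_on_matrix_mult continuous_on_const
      continuous_on_apply_hom[OF f continuous_on_outer[OF x continuous_on_const] hom])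

lemma maximizers_nonempty:
  assumes \<phi>: "unital_star_hom \<phi>"
  shows "maximizers \<phi> \<noteq> {}"
proof -
  have "axis undefined 1 \<in> (sphere 0 1 :: (complex ^ 'k) set)" by (simp add: norm_axis_complex)
  then have "(sphere 0 1 :: (complex ^ 'k) set) \<noteq> {}" by blast
  moreover have "continuous_on (sphere 0 1) (overlap \<phi>)"
    using continuous_on_overlap[of _ "\<lambda>_. \<phi>" "\<lambda>x. x"] \<phi> by simp
  ultimately obtain x where x: "x \<in> sphere 0 1" "\<forall>x' \<in> sphere 0 1. overlap \<phi> x' \<le> overlap \<phi> x"
    using continuous_attains_sup[OF compact_sphere] by blast
  have "continuous_on (unitary :: 'k cmat set) (\<lambda>u. Re (trace (star u ** transition \<phi> x)))"
    by (intro continuous_intros)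
  then obtain u where "u \<in> unitary"
      "\<forall>u' \<in> unitary. Re (trace (star u' ** transition \<phi> x)) \<le> Re (trace (star u ** transition \<phi> x))"
    using continuous_attains_sup[OF compact_unitary] one_unitary by blast
  with x have "(x, u) \<in> maximizers \<phi>" by (simp add: maximizers_def)
  then show ?thesis by blast
qed

lemma closedin_maximizers:
  assumes f: "continuous_on T f" and x: "continuous_on T x" and u: "continuous_on T u"
    and hom: "\<And>s. s \<in> T \<Longrightarrow> unital_star_hom (f s)"
    and K: "\<And>s. s \<in> T \<Longrightarrow> x s \<in> sphere 0 1 \<and> u s \<in> unitary"
  shows "closedin (top_of_set T) {s \<in> T. (x s, u s) \<in> maximizers (f s)}"
proof -
  have "closedin (top_of_set T) {s \<in> T. \<forall>x' \<in> sphere 0 1. overlap (f s) x' \<le> overlap (f s) (x s)}"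
    by (intro closedin_family_le continuous_on_overlap f x hom continuous_on_const)
  moreover have "closedin (top_of_set T) {s \<in> T. \<forall>u' \<in> unitary.
      Re (trace (star u' ** transition (f s) (x s))) \<le> Re (trace (star (u s) ** transition (f s) (x s)))}"
    by (intro closedin_family_le continuous_on_Re continuous_on_trace continuous_on_matrix_mult
        continuous_on_star continuous_on_const continuous_on_transition f x u hom)
  ultimately have "closedin (top_of_set T)
     ({s \<in> T. \<forall>x' \<in> sphere 0 1. overlap (f s) x' \<le> overlap (f s) (x s)} \<inter>
      {s \<in> T. \<forall>u' \<in> unitary.
      Re (trace (star u' ** transition (f s) (x s))) \<le> Re (trace (star (u s) ** transition (f s) (x s)))})"
    by (rule closedin_Int)
  moreover have "({s \<in> T. \<forall>x' \<in> sphere 0 1. overlap (f s) x' \<le> overlap (f s) (x s)} \<inter>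
      {s \<in> T. \<forall>u' \<in> unitary.
      Re (trace (star u' ** transition (f s) (x s))) \<le> Re (trace (star (u s) ** transition (f s) (x s)))})
      = {s \<in> T. (x s, u s) \<in> maximizers (f s)}"
    using K by (auto simp: maximizers_def)
  ultimately show ?thesis by simp
qed

text \<open>
  The complement is the projection of a closed set along the compact space of all \<open>((x, u), z)\<close>.
\<close>

lemma openin_slice_domain: "openin Fr slice_domain"
proof -
  let ?K = "(sphere 0 1 \<times> unitary) \<times> sphere 0 1 :: (((complex ^ 'k) \<times> 'k cmat) \<times> (complex ^ 'k)) set"
  let ?T = "(hom_set :: ('k cmat \<Rightarrow> ('k \<times> 'l) cmat) set) \<times> ?K"
  have K: "compact_space (top_of_set ?K)"
    by (intro compact_space_subtopology) (simp add: compact_Times compact_unitary)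
  have prod: "prod_topology Fr (top_of_set ?K) = top_of_set ?T"
    unfolding Fr_def by (rule prod_topology_subtopology_eu)
  let ?B1 = "{s \<in> ?T. (fst (fst (snd s)), snd (fst (snd s))) \<in> maximizers (fst s)}"
  let ?B2 = "{s \<in> ?T. degenerate (fst s) (fst (snd s)) (snd (snd s))}"
  have cts: "continuous_on ?T fst" "continuous_on ?T (\<lambda>s. fst (fst (snd s)))"
      "continuous_on ?T (\<lambda>s. snd (fst (snd s)))" "continuous_on ?T (\<lambda>s. snd (snd s))"
    by (intro continuous_intros)+
  have hom: "unital_star_hom (fst s)" if "s \<in> ?T" for s using that by auto
  have "closedin (top_of_set ?T) ?B1"
    by (rule closedin_maximizers[OF cts(1,2,3)]) auto
  moreover have "closedin (top_of_set ?T) ?B2"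
  proof -
    have "closedin (top_of_set ?T) ({s \<in> ?T. cinner (fst (fst (snd s))) (snd (snd s)) = 0} \<inter>
        {s \<in> ?T. complex_of_real (overlap (fst s) (snd (snd s))) = of_real (overlap (fst s) (fst (fst (snd s))))} \<union>
        {s \<in> ?T. cinner (snd (snd s)) ((star (snd (fst (snd s))) ** transition (fst s) (fst (fst (snd s)))) *v snd (snd s)) = 0})"
      by (intro closedin_Un closedin_Int closedin_eq continuous_on_cinner continuous_on_of_real
          continuous_on_matrix_vector_mult continuous_on_matrix_mult continuous_on_star
          continuous_on_overlap continuous_on_transition cts hom continuous_on_const)
    moreover have "({s \<in> ?T. cinner (fst (fst (snd s))) (snd (snd s)) = 0} \<inter>
        {s \<in> ?T. complex_of_real (overlap (fst s) (snd (snd s))) = of_real (overlap (fst s) (fst (fst (snd s))))} \<union>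
        {s \<in> ?T. cinner (snd (snd s)) ((star (snd (fst (snd s))) ** transition (fst s) (fst (fst (snd s)))) *v snd (snd s)) = 0})
        = ?B2"
      by (auto simp: degenerate_def case_prod_unfold)
    ultimately show ?thesis by simp
  qed
  ultimately have "closedin (prod_topology Fr (top_of_set ?K)) (?B1 \<inter> ?B2)"
    unfolding prod by (rule closedin_Int)
  then have "closedin Fr (fst ` (?B1 \<inter> ?B2))"
    using Abstract_Topological_Spaces.closed_map_fst[OF K] unfolding closed_map_def by blast
  moreover have "fst ` (?B1 \<inter> ?B2) = topspace Fr - slice_domain"
  proof (intro subset_antisym subsetI)
    fix \<phi> assume "\<phi> \<in> fst ` (?B1 \<inter> ?B2)"
    then show "\<phi> \<in> topspace Fr - slice_domain"
      unfolding topspace_Fr slice_domain_def by force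
  next
    fix \<phi> assume \<phi>: "\<phi> \<in> topspace Fr - slice_domain"
    then obtain x u z where m: "(x, u) \<in> maximizers \<phi>" "z \<in> sphere 0 1" "degenerate \<phi> (x, u) z"
      by (auto simp: topspace_Fr slice_domain_def)
    then have "(\<phi>, (x, u), z) \<in> ?B1 \<inter> ?B2"
      using \<phi> by (auto simp: topspace_Fr maximizers_def)
    then show "\<phi> \<in> fst ` (?B1 \<inter> ?B2)" by (rule rev_image_eqI) simp
  qed
  ultimately have "closedin Fr (topspace Fr - slice_domain)" by simp
  then show ?thesis
    by (subst openin_closedin_eq) (auto simp: slice_domain_def topspace_Fr)
qed

section \<open>Uniqueness of the maximizers\<close>

lemma overlap_scale:
  assumes \<phi>: "unital_star_hom \<phi>"
  shows "overlap \<phi> (c *s x) = (cmod c)\<^sup>2 * overlap \<phi> x"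
proof -
  have "trace (\<phi> (outer (c *s x) (c *s x)) ** \<phi>0 (unit_matrix i0 i0))
      = of_real ((cmod c)\<^sup>2) * trace (\<phi> (outer x x) ** \<phi>0 (unit_matrix i0 i0))"
    unfolding complex_norm_square
    by (simp add: outer_scale_left outer_scale_right cscale_cscale unital_star_hom_cscale[OF \<phi>]
        cscale_mult_left trace_cscale mult.commute)
  then show ?thesis by (simp add: overlap_def del: of_real_power)
qed

lemma overlap_parallelogram:
  assumes \<phi>: "unital_star_hom \<phi>"
  shows "overlap \<phi> (x + y) + overlap \<phi> (x - y) = 2 * overlap \<phi> x + 2 * overlap \<phi> y"
  by (simp add: overlap_def outer_add_left outer_add_right outer_diff_left outer_diff_right
      unital_star_hom_add[OF \<phi>] unital_star_hom_diff[OF \<phi>] matrix_add_rdistr matrix_diff_rdistrib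
      trace_add trace_sub)

lemma transition_scale:
  assumes \<phi>: "unital_star_hom \<phi>"
  shows "transition \<phi> (c *s x) = cscale c (transition \<phi> x)"
  by (simp add: transition_def cscale_def[of c "\<chi> j i. f j i" for f] outer_scale_left
      unital_star_hom_cscale[OF \<phi>] cscale_mult_left trace_cscale)

text \<open>
  The vectors differ by a phase \<open>c\<close>.  The transition matrix is then multiplied by \<open>c\<close>, and by
  uniqueness of the polar part so is \<open>u\<close>.
\<close>

lemma maximizers_same_Ad:
  assumes \<phi>: "\<phi> \<in> slice_domain" and m: "(x, u) \<in> maximizers \<phi>" and m': "(x', u') \<in> maximizers \<phi>"
  shows "Ad (star u) = Ad (star u')"
proof -
  have hom: "unital_star_hom \<phi>" using \<phi> by (simp add: slice_domain_def)
  have nd: "\<not> degenerate \<phi> (x, u) z" if "norm z = 1" for z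
    using \<phi> m that by (auto simp: slice_domain_def)
  define c where "c = cinner x x'"
  have x'x: "x' = c *s x"
    unfolding c_def
  proof (rule quadratic_maximizer_unique[where Q = "overlap \<phi>"])
    show "overlap \<phi> z \<noteq> overlap \<phi> x" if "norm z = 1" "cinner x z = 0" for z
      using nd[OF that(1)] that(2) by (simp add: degenerate_def)
  qed (use m m' in \<open>auto simp: maximizers_def overlap_scale[OF hom] overlap_parallelogram[OF hom]\<close>)
  have c1: "cmod c = 1"
    using m m' norm_cscale_vec[of c x] by (simp add: maximizers_def x'x)
  then have cc: "c * cnj c = 1" by (simp add: complex_norm_square[symmetric])
  have u: "polar_maximizer (transition \<phi> x) u" by (rule maximizers_polar[OF m])
  have u': "polar_maximizer (cscale c (transition \<phi> x)) u'"
    using maximizers_polar[OF m'] by (simp add: x'x transition_scale[OF hom])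
  have "polar_maximizer (transition \<phi> x) (cscale (cnj c) u')"
    unfolding polar_maximizer_def
  proof (intro conjI ballI)
    show "cscale (cnj c) u' \<in> unitary"
      using u' c1 by (intro unitary_cscale) (simp_all add: polar_maximizer_def)
    fix v :: "'k cmat" assume "v \<in> unitary"
    then have "cscale c v \<in> unitary" by (intro unitary_cscale c1)
    then have "Re (trace (star (cscale c v) ** cscale c (transition \<phi> x)))
        \<le> Re (trace (star u' ** cscale c (transition \<phi> x)))"
      using u' unfolding polar_maximizer_def by blast
    then show "Re (trace (star v ** transition \<phi> x)) \<le> Re (trace (star (cscale (cnj c) u') ** transition \<phi> x))"
      by (simp add: star_cscale cscale_mult_left cscale_mult_right cscale_cscale cc mult.commute[of "cnj c"])
  qed
  then have "cscale (cnj c) u' = u"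
    by (rule polar_maximizer_unique[OF u]) (use nd in \<open>auto simp: degenerate_def\<close>)
  then have "star u = star (cscale (cnj c) u')" by simp
  then have "star u = cscale c (star u')" by (simp add: star_cscale)
  moreover have "star u \<in> unitary" "star u' \<in> unitary"
    using m m' by (auto simp: maximizers_def intro: unitary_star)
  ultimately show ?thesis using Ad_eq_iff c1 by blast
qed

lemma slice_map_eq:
  assumes \<phi>: "\<phi> \<in> slice_domain" and m: "(x, u) \<in> maximizers \<phi>"
  shows "slice_map \<phi> = Ad (star u)"
proof -
  obtain x' u' where s: "(SOME m. m \<in> maximizers \<phi>) = (x', u')" by fastforce
  have "(x', u') \<in> maximizers \<phi>" unfolding s[symmetric] using m by (rule someI)
  then show ?thesis using maximizers_same_Ad[OF \<phi> m] by (simp add: slice_map_def s)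
qed

lemma continuous_map_slice_map: "continuous_map (subtopology Fr slice_domain) PU slice_map"
proof -
  let ?K = "sphere 0 1 \<times> unitary :: ((complex ^ 'k) \<times> 'k cmat) set"
  let ?T = "slice_domain \<times> ?K"
  have sub: "slice_domain \<subseteq> hom_set" by (auto simp: slice_domain_def)
  then have Fr: "subtopology Fr slice_domain = top_of_set slice_domain"
    by (simp add: Fr_def subtopology_subtopology Int_absorb1)
  have "closedin (top_of_set ?T) {s \<in> ?T. (fst (snd s), snd (snd s)) \<in> maximizers (fst s)}"
    using sub
    by (intro closedin_maximizers continuous_on_fst continuous_on_snd continuous_on_id) auto
  then have R: "closedin (prod_topology (subtopology Fr slice_domain) (top_of_set ?K))
      {s \<in> ?T. snd s \<in> maximizers (fst s)}"
    unfolding Fr by simp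
  have f: "continuous_map (top_of_set ?K) PU (\<lambda>m. Ad (star (snd m)))"
  proof -
    have "continuous_map (top_of_set ?K) (top_of_set unitary) (\<lambda>m. star (snd m))"
      by (auto simp: continuous_map_in_subtopology unitary_star intro!: continuous_intros)
    from continuous_map_compose[OF this quotient_imp_continuous_map[OF quotient_map_Ad]]
    show ?thesis by (simp add: o_def)
  qed
  show ?thesis
  proof (rule continuous_map_of_closed_relation[OF _ R f])
    show "compact_space (top_of_set ?K)"
      by (intro compact_space_subtopology) (simp add: compact_Times compact_unitary)
    show "\<exists>k. (\<phi>, k) \<in> {s \<in> ?T. snd s \<in> maximizers (fst s)}" if "\<phi> \<in> topspace (subtopology Fr slice_domain)" for \<phi>
    proof -
      have \<phi>: "\<phi> \<in> slice_domain" using that by simp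
      then obtain m where "m \<in> maximizers \<phi>" using maximizers_nonempty sub by blast
      then show ?thesis using \<phi> by (intro exI[of _ m]) (auto simp: maximizers_def)
    qed
    show "slice_map \<phi> = Ad (star (snd k))" if "(\<phi>, k) \<in> {s \<in> ?T. snd s \<in> maximizers (fst s)}" for \<phi> k
      using that by (cases k) (auto simp: slice_map_eq)
  qed
qed

section \<open>Equivariance of the maximizers\<close>

lemma overlap_Ad: "overlap (\<phi> \<circ> Ad w) x = overlap \<phi> (w *v x)"
  by (simp add: overlap_def Ad_outer)

text \<open>
  The matrix depends on its row index through \<open>\<phi>(x e\<^sub>j\<^sup>*)\<close>, which is conjugate linear in \<open>e\<^sub>j\<close>; hence
  replacing \<open>e\<^sub>j\<close> by \<open>w e\<^sub>j\<close> multiplies it by \<open>w\<^sup>*\<close> on the left.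
\<close>

lemma transition_Ad:
  assumes \<phi>: "unital_star_hom \<phi>"
  shows "transition (\<phi> \<circ> Ad w) x = star w ** transition \<phi> (w *v x)"
proof -
  have "transition (\<phi> \<circ> Ad w) x $ j $ i = (star w ** transition \<phi> (w *v x)) $ j $ i" for j i
  proof -
    have sum_mult: "(\<Sum>m\<in>S. f m) ** b = (\<Sum>m\<in>S. f m ** b)" for S and f :: "'k \<Rightarrow> ('k \<times> 'l) cmat" and b
      by (induction S rule: infinite_finite_induct) (simp_all add: matrix_add_rdistr)
    have "outer (w *v x) (w *v axis j 1) = (\<Sum>m\<in>UNIV. cscale (cnj (w $ m $ j)) (outer (w *v x) (axis m 1)))"
      using outer_eq_sum[of "w *v x" "w *v axis j 1"] by (simp only: matrix_vector_axis_nth)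
    then show ?thesis
      by (simp add: transition_def Ad_outer unital_star_hom_sum[OF \<phi>] unital_star_hom_cscale[OF \<phi>]
          sum_mult cscale_mult_left trace_sum trace_cscale)
         (simp add: matrix_matrix_mult_def star_def)
  qed
  then show ?thesis by (simp add: vec_eq_iff)
qed

lemma maximizers_Ad:
  assumes \<phi>: "unital_star_hom \<phi>" and w: "w \<in> unitary" and m: "(x, u) \<in> maximizers \<phi>"
  shows "(star w *v x, star w ** u) \<in> maximizers (\<phi> \<circ> Ad w)"
proof -
  have ww: "w ** star w = mat 1" "star w ** w = mat 1" using w by (auto simp: unitary_def)
  have x: "norm x = 1" "\<And>x'. norm x' = 1 \<Longrightarrow> overlap \<phi> x' \<le> overlap \<phi> x" and u: "u \<in> unitary"
    "\<And>u'. u' \<in> unitary \<Longrightarrow> Re (trace (star u' ** transition \<phi> x)) \<le> Re (trace (star u ** transition \<phi> x))"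
    using m by (auto simp: maximizers_def)
  have wx: "w *v (star w *v x) = x" by (simp add: matrix_vector_mul_assoc ww)
  have t: "star v ** transition (\<phi> \<circ> Ad w) (star w *v x) = star (w ** v) ** transition \<phi> x" for v
    by (simp add: transition_Ad[OF \<phi>] wx star_mult matrix_mul_assoc)
  have wu: "w ** (star w ** u) = u" by (simp add: matrix_mul_assoc ww)
  show ?thesis
    unfolding maximizers_def
    using x u w by (auto simp: t wu overlap_Ad wx norm_unitary_vec unitary_star unitary_mult)
qed

lemma degenerate_Ad:
  assumes \<phi>: "unital_star_hom \<phi>" and w: "w \<in> unitary" and d: "degenerate \<phi> (x, u) z" and z: "norm z = 1"
  shows "\<exists>z' \<in> sphere 0 1. degenerate (\<phi> \<circ> Ad w) (star w *v x, star w ** u) z'"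
proof -
  have ww: "w ** star w = mat 1" using w by (auto simp: unitary_def)
  have wx: "w *v (star w *v y) = y" for y by (simp add: matrix_vector_mul_assoc ww)
  have c: "cinner (star w *v y) (star w *v y') = cinner y y'" for y y'
    by (simp add: cinner_adjoint wx)
  have "star (star w ** u) ** transition (\<phi> \<circ> Ad w) (star w *v x) = star u ** (w ** star w) ** transition \<phi> x"
    by (simp only: transition_Ad[OF \<phi>] wx star_mult star_star matrix_mul_assoc)
  then have t: "star (star w ** u) ** transition (\<phi> \<circ> Ad w) (star w *v x) = star u ** transition \<phi> x"
    by (simp add: ww)
  from d consider "cinner x z = 0" "overlap \<phi> z = overlap \<phi> x" | "cinner z ((star u ** transition \<phi> x) *v z) = 0"
    by (auto simp: degenerate_def)
  then show ?thesis
  proof cases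
    case 1
    then show ?thesis
      using z w by (intro bexI[of _ "star w *v z"])
        (auto simp: degenerate_def overlap_Ad wx c norm_unitary_vec unitary_star)
  next
    case 2
    then show ?thesis using z by (intro bexI[of _ z]) (auto simp: degenerate_def t)
  qed
qed

lemma slice_domain_Ad:
  assumes \<phi>: "\<phi> \<in> slice_domain" and w: "w \<in> unitary"
  shows "\<phi> \<circ> Ad w \<in> slice_domain"
proof -
  have hom: "unital_star_hom \<phi>" using \<phi> by (simp add: slice_domain_def)
  have hom': "unital_star_hom (\<phi> \<circ> Ad w)" by (intro unital_star_hom_comp unital_star_hom_Ad hom w)
  have undo: "\<phi> \<circ> Ad w \<circ> Ad (star w) = \<phi>" by (simp add: comp_assoc Ad_comp_star[OF w])
  have "\<not> degenerate (\<phi> \<circ> Ad w) (x, u) z" if m: "(x, u) \<in> maximizers (\<phi> \<circ> Ad w)" and z: "norm z = 1" for x u z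
  proof
    assume "degenerate (\<phi> \<circ> Ad w) (x, u) z"
    from degenerate_Ad[OF hom' unitary_star[OF w] this z] maximizers_Ad[OF hom' unitary_star[OF w] m]
    show False using \<phi> by (auto simp: undo slice_domain_def)
  qed
  then show ?thesis using hom' by (auto simp: slice_domain_def)
qed

lemma slice_map_Ad:
  assumes \<phi>: "\<phi> \<in> slice_domain" and w: "w \<in> unitary"
  shows "slice_map (\<phi> \<circ> Ad w) = slice_map \<phi> \<circ> Ad w"
proof -
  have hom: "unital_star_hom \<phi>" using \<phi> by (simp add: slice_domain_def)
  obtain x u where m: "(x, u) \<in> maximizers \<phi>" using maximizers_nonempty[OF hom] by auto
  show ?thesis
    using slice_map_eq[OF \<phi> m] slice_map_eq[OF slice_domain_Ad[OF \<phi> w] maximizers_Ad[OF hom w m]]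
    by (simp add: Ad_comp star_mult)
qed

section \<open>The reference frame lies in the domain\<close>

text \<open>
  For \<open>\<phi> = \<phi>0\<close> everything is explicit: the overlap of \<open>x\<close> is \<open>l \<bar>x\<^sub>i\<^sub>0\<bar>\<^sup>2\<close>, so a maximal \<open>x\<close> is a
  phase \<open>c\<close> times the axis \<open>i0\<close>; the transition matrix is \<open>l c\<close> times the identity; and its
  polar part is \<open>c\<close> times the identity, which leaves \<open>l\<close> times the identity as the positive part.
\<close>

lemma reference_in_slice_domain: "\<phi>0 \<in> slice_domain"
proof -
  define l where "l = real (CARD('l))"
  have l: "l > 0" by (simp add: l_def)
  have pairing: "trace (\<phi>0 (outer x y) ** \<phi>0 (unit_matrix i i0)) = l * (cinner y (axis i 1) * x $ i0)" for x y i
  proof -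
    have "\<phi>0 (outer x y) ** \<phi>0 (unit_matrix i i0) = \<phi>0 (outer x y ** unit_matrix i i0)"
      by (simp add: unital_star_hom_mult[OF \<phi>0])
    then show ?thesis
      by (simp add: trace_unital_star_hom[OF \<phi>0] unit_matrix_def outer_outer trace_cscale trace_outer cinner_axis l_def)
  qed
  have axis: "cinner y (axis i 1) = cnj (y $ i)" for y :: "complex ^ 'k" and i
    using cinner_commute[of y "axis i 1"] by (simp add: cinner_axis)
  have overlap: "overlap \<phi>0 x = l * (cmod (x $ i0))\<^sup>2" for x
  proof -
    have "cnj (x $ i0) * x $ i0 = of_real ((cmod (x $ i0))\<^sup>2)"
      unfolding complex_norm_square by (rule mult.commute)
    then show ?thesis by (simp add: overlap_def pairing axis del: of_real_power)
  qed
  have trans: "transition \<phi>0 x = cscale (l * x $ i0) (mat 1)" for x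
  proof -
    have "transition \<phi>0 x $ j $ i = cscale (l * x $ i0) (mat 1) $ j $ i" for i j
      unfolding transition_def vec_lambda_beta pairing axis
      by (simp add: axis_def cscale_def mat_def)
    then show ?thesis by (simp add: vec_eq_iff)
  qed
  have "\<not> degenerate \<phi>0 (x, u) z" if m: "(x, u) \<in> maximizers \<phi>0" and z: "norm z = 1" for x u z
  proof -
    have x: "norm x = 1" and u: "u \<in> unitary" using m by (auto simp: maximizers_def)
    have "overlap \<phi>0 (axis i0 1) \<le> overlap \<phi>0 x" using m by (auto simp: maximizers_def norm_axis_complex)
    then have "1 \<le> (cmod (x $ i0))\<^sup>2" using l by (simp add: overlap axis_def)
    moreover have nx: "(\<Sum>i\<in>UNIV. (cmod (x $ i))\<^sup>2) = 1"
      using x by (simp add: norm_vec_def L2_set_def)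
    have split: "(\<Sum>i\<in>UNIV. (cmod (x $ i))\<^sup>2) = (cmod (x $ i0))\<^sup>2 + (\<Sum>i\<in>UNIV - {i0}. (cmod (x $ i))\<^sup>2)"
      by (rule sum.remove) auto
    moreover have "0 \<le> (\<Sum>i\<in>UNIV - {i0}. (cmod (x $ i))\<^sup>2)" by (rule sum_nonneg) simp
    ultimately have one: "(cmod (x $ i0))\<^sup>2 = 1" and "(\<Sum>i\<in>UNIV - {i0}. (cmod (x $ i))\<^sup>2) = 0"
      using nx by linarith+
    then have off: "x $ i = 0" if "i \<noteq> i0" for i
      using that by (subst (asm) sum_nonneg_eq_0_iff) auto
    define c where "c = x $ i0"
    have c: "cmod c = 1" using one by (metis c_def norm_ge_zero one_power2 power2_eq_imp_eq zero_le_one)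
    then have cc: "c * cnj c = 1" by (simp add: complex_norm_square[symmetric])
    have "cinner x z = (\<Sum>i\<in>UNIV. if i = i0 then cnj c * z $ i0 else 0)"
      unfolding cinner_def by (intro sum.cong refl) (auto simp: off c_def)
    then have xz: "cinner x z = cnj c * z $ i0" by simp
    have "overlap \<phi>0 z \<noteq> overlap \<phi>0 x" if "cinner x z = 0"
    proof -
      have "z $ i0 = 0" using that c by (auto simp: xz)
      then show ?thesis using one l by (simp add: overlap)
    qed
    moreover have "cinner z ((star u ** transition \<phi>0 x) *v z) \<noteq> 0"
    proof -
      have "cscale c (mat 1) \<in> unitary" by (intro unitary_cscale c one_unitary)
      then have "Re (trace (star (cscale c (mat 1)) ** transition \<phi>0 x)) \<le> Re (trace (star u ** transition \<phi>0 x))"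
        using m by (auto simp: maximizers_def)
      moreover have "star (cscale c (mat 1)) ** transition \<phi>0 x = cscale l (mat 1)"
        by (simp add: trans star_cscale cscale_mult_left cscale_cscale c_def[symmetric])
           (simp add: mult.left_commute mult.commute[of "cnj c"] mult.assoc cc)
      moreover have su: "star u ** transition \<phi>0 x = cscale l (cscale c (star u))"
        by (simp add: trans cscale_mult_right cscale_cscale c_def)
      ultimately have "l * real (CARD('k)) \<le> l * Re (trace (cscale c (star u)))"
        by (simp add: trace_cscale[of "complex_of_real l"] trace_I)
      then have "real (CARD('k)) \<le> Re (trace (cscale c (star u)))" using l by simp
      then have "cscale c (star u) = mat 1"
        by (intro unitary_eq_one_if_trace unitary_cscale c unitary_star u)
      then have "(star u ** transition \<phi>0 x) *v z = complex_of_real l *s z"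
        unfolding su by (simp add: cscale_def matrix_vector_mult_def mat_def vec_eq_iff
            if_distrib[of "\<lambda>c. _ * c"] if_distrib[of "\<lambda>c. c * _"] cong: if_cong)
      then show ?thesis using l z by (simp add: cinner_scale_right cinner_self)
    qed
    ultimately show ?thesis by (auto simp: degenerate_def)
  qed
  then show ?thesis using \<phi>0 by (auto simp: slice_domain_def)
qed

end

theorem proposition2:
  fixes EPU :: "'e topology"
    and act :: "'e \<Rightarrow> ('k::finite cmat \<Rightarrow> 'k cmat) \<Rightarrow> 'e"
  assumes "universal_principal_bundle PU (\<circ>) id EPU act"
  shows "(hom_bundle EPU act :: ('e \<times> ('k cmat \<Rightarrow> ('k \<times> 'l::finite) cmat)) set topology)
           homotopy_equivalent_space (Gr :: ('k \<times> 'l) cmat set topology)"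
proof -
  have E: "continuous_right_action PU (\<circ>) id EPU act" "contractible_space EPU" "topspace EPU \<noteq> {}"
    using assms by (auto simp: universal_principal_bundle_def principal_bundle_def)
  interpret compact_group "PU :: ('k cmat \<Rightarrow> 'k cmat) topology" "(\<circ>)" id inv
    by (rule compact_group_PU)
  interpret two_actions "PU :: ('k cmat \<Rightarrow> 'k cmat) topology" "(\<circ>)" id inv EPU act
      "Fr :: ('k cmat \<Rightarrow> ('k \<times> 'l) cmat) topology" "(\<circ>)"
    by unfold_locales (rule E(1), rule Fr_action)
  have shrink: "shrinkable_over (topspace (Fr :: ('k cmat \<Rightarrow> ('k \<times> 'l) cmat) topology))"
  proof (rule shrinkable_over_compact[OF compact_space_Fr])
    fix \<phi> :: "'k cmat \<Rightarrow> ('k \<times> 'l) cmat" assume "\<phi> \<in> topspace Fr"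
    then interpret reference_frame \<phi> undefined by unfold_locales (simp add: topspace_Fr)
    show "\<exists>V. openin Fr V \<and> \<phi> \<in> V \<and> shrinkable_over V"
      by (rule locally_shrinkable[OF E(2) completely_regular_space_Fr openin_slice_domain
            reference_in_slice_domain _ continuous_map_slice_map])
         (auto simp: topspace_PU slice_domain_Ad slice_map_Ad)
  qed
  have "orbit_space (prod_topology EPU (Fr :: ('k cmat \<Rightarrow> ('k \<times> 'l) cmat) topology)) diagonal (topspace PU)
      homotopy_equivalent_space (Gr :: ('k \<times> 'l) cmat set topology)"
    by (rule borel_construction_homotopy_equivalent[OF shrink E(3) quotient_map_Fr_Gr])
       (simp add: topspace_Fr range_eq_iff_same_PU_orbit)
  then show ?thesis by (simp add: hom_bundle_def diagonal_def)
qed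

end
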